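(* Let $n,d\ge1$ and $k\ge2$ be integers, let $\xi\in\mathbb{C}$ be a primitive $k$-th root of unity, let $I_{n,k,d}\subset S=\mathbb{C}[x_0,\ldots,x_n]$ be the ideal generated by all forms $(x_0+\xi^{g_1}x_1+\cdots+\xi^{g_n}x_n)^{(k-1)d}$ with $0\le g_i\le k-1$, and let $R_{n,k,d}=S/I_{n,k,d}$. Then for all $j=0,\ldots,d-2$, with $i=(k-1)d+j$, $$\dim_{\mathbb{C}}[R_{n,k,d}]_i=\sum_{\substack{s\in\mathbb{N}\\ s\le\frac{k-1}{k}(d-j)}}(-1)^{s+1}\binom{n+(k-1)(d-j)-ks}{n}\binom{j+s-1}{s-1}\binom{j+n}{n-s}.$$
   Context: $[R_{n,k,d}]_i$ is the degree-$i$ component in the standard grading. $\mathbb{N}$ is the set of natural numbers; binomial coefficients $\binom{a}{b}$ with $b<0$ are $0$, so only the terms with $1\le s\le n$ contribute. *)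

theory Defs
  imports Complex_Main "HOL-Library.Poly_Mapping"
    "HOL-Algebra.QuotRing" "HOL-Algebra.Embedded_Algebras"
begin

text \<open>
  A polynomial is a finitely supported map from exponent vectors to coefficients; the variables
  are indexed by all natural numbers, and \<open>poly_ring n\<close> below is the subring
  $\mathbf{C}[x_0,\ldots,x_n]$.
\<close>

type_synonym cpoly = "(nat \<Rightarrow>\<^sub>0 nat) \<Rightarrow>\<^sub>0 complex"

definition pconst :: "complex \<Rightarrow> cpoly" where
  "pconst c = Poly_Mapping.single 0 c"

definition pvar :: "nat \<Rightarrow> cpoly" where
  "pvar l = Poly_Mapping.single (Poly_Mapping.single l 1) 1"

definition poly_ring :: "nat \<Rightarrow> cpoly ring" where
  "poly_ring n =
     \<lparr> carrier = {p. \<forall>m \<in> Poly_Mapping.keys p. Poly_Mapping.keys m \<subseteq> {0..n}},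
       monoid.mult = (*), one = 1, ring.zero = 0, add = (+) \<rparr>"

definition mon_degree :: "(nat \<Rightarrow>\<^sub>0 nat) \<Rightarrow> nat" where
  "mon_degree m = (\<Sum>l \<in> Poly_Mapping.keys m. Poly_Mapping.lookup m l)"

text \<open>The zero polynomial belongs to every \<open>homogeneous_part n i\<close>.\<close>

definition homogeneous_part :: "nat \<Rightarrow> nat \<Rightarrow> cpoly set" where
  "homogeneous_part n i =
     {p \<in> carrier (poly_ring n). \<forall>m \<in> Poly_Mapping.keys p. mon_degree m = i}"

definition primitive_root_of_unity :: "nat \<Rightarrow> complex \<Rightarrow> bool" where
  "primitive_root_of_unity k \<xi> \<longleftrightarrow> \<xi> ^ k = 1 \<and> (\<forall>m. 0 < m \<and> m < k \<longrightarrow> \<xi> ^ m \<noteq> 1)"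

definition lin_form :: "nat \<Rightarrow> complex \<Rightarrow> (nat \<Rightarrow> nat) \<Rightarrow> cpoly" where
  "lin_form n \<xi> g = pvar 0 + (\<Sum>l = 1..n. pconst (\<xi> ^ g l) * pvar l)"

definition I_ideal :: "nat \<Rightarrow> nat \<Rightarrow> nat \<Rightarrow> complex \<Rightarrow> cpoly set" where
  "I_ideal n k d \<xi> =
     genideal (poly_ring n)
       {lin_form n \<xi> g ^ ((k - 1) * d) | g. \<forall>l \<in> {1..n}. g l \<le> k - 1}"

definition R_ring :: "nat \<Rightarrow> nat \<Rightarrow> nat \<Rightarrow> complex \<Rightarrow> cpoly set ring" where
  "R_ring n k d \<xi> = poly_ring n Quot I_ideal n k d \<xi>"

definition R_class :: "nat \<Rightarrow> nat \<Rightarrow> nat \<Rightarrow> complex \<Rightarrow> cpoly \<Rightarrow> cpoly set" where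
  "R_class n k d \<xi> p = I_ideal n k d \<xi> +>\<^bsub>poly_ring n\<^esub> p"

text \<open>
  The library notion \<open>ring.dimension\<close> measures dimension over a subfield of the ambient ring;
  here this is the copy of the complex numbers formed by the classes of the constants.
\<close>

definition R_scalars :: "nat \<Rightarrow> nat \<Rightarrow> nat \<Rightarrow> complex \<Rightarrow> cpoly set set" where
  "R_scalars n k d \<xi> = R_class n k d \<xi> ` range pconst"

text \<open>
  The ideal is generated by forms, so the grading of the quotient is the one induced from the
  polynomial ring: its component of degree \<open>i\<close> is the image of the forms of degree \<open>i\<close>.
\<close>

definition R_component :: "nat \<Rightarrow> nat \<Rightarrow> nat \<Rightarrow> complex \<Rightarrow> nat \<Rightarrow> cpoly set set" where
  "R_component n k d \<xi> i = R_class n k d \<xi> ` homogeneous_part n i"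

text \<open>
  Binomial coefficients with integer entries, zero if the lower one is negative. (With truncated
  subtraction on the naturals, a term with \<open>s = 0\<close> or \<open>s > n\<close> could wrongly be nonzero.)
\<close>

definition ibinom :: "int \<Rightarrow> int \<Rightarrow> real" where
  "ibinom a b = (if b < 0 then 0 else real_of_int a gchoose nat b)"

end

theory Submission
  imports Defs
begin

text \<open>
  Put $D = (k-1)d$ and $i = D + j$, and write a form $p$ of degree $i$ as
  $\sum_e f(e)\, x^e / e!$, the sum over the exponent vectors $e$ of degree $i$. Multiplying the
  power of the linear form attached to $g$ by a monomial $x^b$ of degree $j$ gives, up to a nonzero
  constant, $f(e) = \xi^{g_1 e_1 + \cdots + g_n e_n} \prod_l e_l (e_l - 1) \cdots (e_l - b_l + 1)$.
  The first factor is a character of $(\mathbf{Z}/k)^n$, the second a polynomial of degree $j$; on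
  the hyperplane $|e| = i$ the coordinate $e_0$ can be eliminated. Hence the degree-$i$ part of the
  ideal consists exactly of the $p$ for which $f$ is, on each residue class of $(e_1,\ldots,e_n)$
  modulo $k$, a polynomial of degree at most $j$ in $e_1,\ldots,e_n$. These quasi-polynomials are
  formalised by \<open>quasi_poly\<close>; the two inclusions are \<open>dp_form_quasi_poly\<close> and \<open>quasi_poly_part_I\<close>.

  Within one residue class $e$ is determined by the quotients $c_l = e_l$ div $k$ ($1 \le l \le n$),
  which run over a simplex $|c| \le M$. A polynomial of degree at most $j$ in $c$ is determined by
  its values at the points with $|c| \le j$ (\<open>differences_vanish_unique\<close>), and the Newton basis
  shows that these values can be prescribed. Therefore the monomials $x^e$ with $|e| = i$ and
  $\sum_{l=1}^n (e_l \mathbin{\mathrm{div}} k) > j$ form a basis of the degree-$i$ component of the quotient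
  (\<open>std_independent\<close>, \<open>std_span\<close>, \<open>dimension_R_component\<close>).

  It remains to count them. Let $a_t$ be the number of ways to choose $e_0$ and the residues of
  $e_1,\ldots,e_n$ with total $i - kt$. There are $\binom{n-1+t}{n-1}\, a_t$ exponent vectors of
  degree $i$ with quotients of sum $t$, so the dimension is
  $\sum_{u \ge 1} \binom{n-1+j+u}{n-1} a_{j+u}$. In the same way
  $\binom{n+i-k(j+s)}{n} = \sum_{u \ge s} \binom{n-1+u-s}{n-1} a_{j+u}$. Comparing the
  coefficients of $a_{j+u}$ reduces the claimed formula to the identity \<open>binomial_identity\<close>, which is
  Lagrange interpolation of a polynomial of degree at most $n-1$ from the points $1,\ldots,n$
  to the point $-j$.
\<close>

section \<open>Exponent vectors and powers of the linear forms\<close>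

abbreviation "lookup \<equiv> Poly_Mapping.lookup"
abbreviation "keys \<equiv> Poly_Mapping.keys"
abbreviation "single \<equiv> Poly_Mapping.single"

lemma mon_degree_eq_sum:
  assumes "finite A" "keys e \<subseteq> A"
  shows "mon_degree e = (\<Sum>l\<in>A. lookup e l)"
  unfolding mon_degree_def using assms
  by (intro sum.mono_neutral_left) (auto simp: in_keys_iff)

lemma keys_add_nat: "keys (a + b) = keys a \<union> keys (b :: nat \<Rightarrow>\<^sub>0 nat)"
  by (auto simp: in_keys_iff lookup_add)

lemma mon_degree_add: "mon_degree (a + b) = mon_degree a + mon_degree b"
  by (simp add: mon_degree_eq_sum[of "keys a \<union> keys b"] keys_add_nat lookup_add sum.distrib)

lemma mon_degree_single: "mon_degree (single l c) = c"
  by (cases "c = 0") (auto simp: mon_degree_def)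

text \<open>The exponents of the monomials of degree \<open>i\<close> in the variables with indices \<open>0, \<dots>, n\<close>.\<close>

definition exps :: "nat \<Rightarrow> nat \<Rightarrow> (nat \<Rightarrow>\<^sub>0 nat) set" where
  "exps n i = {e. keys e \<subseteq> {0..n} \<and> mon_degree e = i}"

lemma exps_degree: "e \<in> exps n i \<Longrightarrow> (\<Sum>l\<le>n. lookup e l) = i"
  using mon_degree_eq_sum[of "{0..n}" e] by (auto simp: exps_def atMost_atLeast0)

lemma add_in_exps_iff:
  "b + e \<in> exps n i \<longleftrightarrow> keys b \<subseteq> {0..n} \<and> mon_degree b \<le> i \<and> e \<in> exps n (i - mon_degree b)"
  by (auto simp: exps_def keys_add_nat mon_degree_add)

lemma finite_bounded_exponents:
  assumes "finite A"
  shows "finite {e :: nat \<Rightarrow>\<^sub>0 nat. keys e \<subseteq> A \<and> mon_degree e \<le> i}" (is "finite ?E")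
proof (rule finite_imageD)
  show "inj_on lookup ?E" by (simp add: inj_on_def)
  have "lookup ` ?E \<subseteq> {f. \<forall>x. (x \<in> A \<longrightarrow> f x \<in> {..i}) \<and> (x \<notin> A \<longrightarrow> f x = 0)}"
  proof clarsimp
    fix e :: "nat \<Rightarrow>\<^sub>0 nat" and x assume e: "keys e \<subseteq> A" "mon_degree e \<le> i"
    have "lookup e x \<le> mon_degree e" if "x \<in> A"
      using member_le_sum[of x A "lookup e"] that assms mon_degree_eq_sum[OF assms e(1)] by simp
    then show "(x \<in> A \<longrightarrow> lookup e x \<le> i) \<and> (x \<notin> A \<longrightarrow> lookup e x = 0)"
      using e by (auto simp: in_keys_iff)
  qed
  then show "finite (lookup ` ?E)"
    by (rule finite_subset) (rule finite_set_of_finite_funs, auto simp: assms)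
qed

lemma finite_exps: "finite (exps n i)"
  by (rule finite_subset[OF _ finite_bounded_exponents[of "{0..n}" i]]) (auto simp: exps_def)

lemma lookup_single_times_add:
  fixes q :: cpoly
  shows "lookup (single b c * q) (b + e) = c * lookup q e"
proof -
  have 1: "(\<Sum>q'. lookup q q' when b + e = b + q') = lookup q e"
    by simp
  show ?thesis
    unfolding lookup_mult lookup_single
    by (simp add: when_mult 1)
qed

lemma lookup_single_times_eq_0:
  fixes q :: cpoly
  assumes "\<And>e'. e \<noteq> b + e'"
  shows "lookup (single b c * q) e = 0"
  unfolding lookup_mult lookup_single using assms by (simp add: when_mult)

lemma exponent_split:
  fixes b e :: "nat \<Rightarrow>\<^sub>0 nat"
  assumes "\<And>l. lookup b l \<le> lookup e l"
  shows "e = b + (e - b)"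
  by (rule poly_mapping_eqI) (use assms in \<open>simp add: lookup_add lookup_minus\<close>)

text \<open>The exponent vector with the entries \<open>f 1, \<dots>, f n\<close> and zeros elsewhere.\<close>

definition coord_vec :: "nat \<Rightarrow> (nat \<Rightarrow> nat) \<Rightarrow> (nat \<Rightarrow>\<^sub>0 nat)" where
  "coord_vec n f = (\<Sum>l=1..n. single l (f l))"

lemma lookup_coord_vec: "lookup (coord_vec n f) l = (if l \<in> {1..n} then f l else 0)"
  by (simp add: coord_vec_def lookup_sum lookup_single when_def)

lemma coord_vec_cong: "(\<And>l. l \<in> {1..n} \<Longrightarrow> f l = g l) \<Longrightarrow> coord_vec n f = coord_vec n g"
  by (simp add: coord_vec_def)

lemma keys_coord_vec: "keys (coord_vec n f) \<subseteq> {1..n}"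
  by (auto simp: in_keys_iff lookup_coord_vec split: if_splits)

lemma mon_degree_coord_vec: "mon_degree (coord_vec n f) = (\<Sum>l=1..n. f l)"
  by (subst mon_degree_eq_sum[OF _ keys_coord_vec]) (auto simp: lookup_coord_vec)

text \<open>The product of the factorials of the entries with indices \<open>0, \<dots>, n\<close>.\<close>

definition efact :: "nat \<Rightarrow> (nat \<Rightarrow>\<^sub>0 nat) \<Rightarrow> complex" where
  "efact n e = (\<Prod>l\<le>n. fact (lookup e l))"

lemma efact_nonzero [simp]: "efact n e \<noteq> 0"
  by (simp add: efact_def)

text \<open>
  The falling factorial $\prod_{l=0}^n e_l (e_l - 1) \cdots (e_l - b_l + 1)$. It is computed in the
  complex numbers, so that it vanishes whenever some $b_l$ exceeds $e_l$.
\<close>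

definition ffact :: "nat \<Rightarrow> (nat \<Rightarrow>\<^sub>0 nat) \<Rightarrow> (nat \<Rightarrow>\<^sub>0 nat) \<Rightarrow> complex" where
  "ffact n b e = (\<Prod>l\<le>n. \<Prod>r<lookup b l. of_nat (lookup e l) - of_nat r)"

lemma fact_eq_falling:
  "(fact (b + c) :: complex) = (\<Prod>r<b. of_nat (b + c) - of_nat r) * fact c"
proof (induction b arbitrary: c)
  case 0 then show ?case by simp
next
  case (Suc b)
  have "(fact (Suc b + c) :: complex) = fact (b + Suc c)" by simp
  also have "\<dots> = (\<Prod>r<b. of_nat (b + Suc c) - of_nat r) * (of_nat (Suc c) * fact c)"
    by (simp only: Suc.IH fact_Suc)
  also have "\<dots> = (\<Prod>r<Suc b. of_nat (Suc b + c) - of_nat r) * fact c"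
    by (simp add: algebra_simps)
  finally show ?case .
qed

lemma efact_add: "efact n (b + e) = ffact n b (b + e) * efact n e"
  unfolding efact_def ffact_def lookup_add prod.distrib[symmetric] fact_eq_falling ..

lemma ffact_eq_0:
  assumes "keys b \<subseteq> {0..n}" "\<And>e'. e \<noteq> b + e'"
  shows "ffact n b e = 0"
proof -
  obtain l where l: "lookup e l < lookup b l"
    using exponent_split[of b e] assms(2) by (meson not_le)
  then have "l \<in> keys b" by (simp add: in_keys_iff)
  then have "l \<le> n" using assms by auto
  have "(\<Prod>r<lookup b l. (of_nat (lookup e l) :: complex) - of_nat r) = 0"
    using l by (intro prod_zero) auto
  then show ?thesis unfolding ffact_def using \<open>l \<le> n\<close> by (intro prod_zero) auto
qed

lemma ffact_0 [simp]: "ffact n 0 e = 1"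
  by (simp add: ffact_def)

lemma ffact_add_single:
  assumes "l \<le> n"
  shows "ffact n (b + single l 1) e = (of_nat (lookup e l) - of_nat (lookup b l)) * ffact n b e"
proof -
  have "ffact n (b + single l 1) e =
    (\<Prod>m\<le>n. (\<Prod>r<lookup b m. of_nat (lookup e m) - of_nat r) *
       (if m = l then of_nat (lookup e l) - of_nat (lookup b l) else 1))"
    unfolding ffact_def by (intro prod.cong) (auto simp: lookup_add lookup_single)
  also have "\<dots> = ffact n b e * (of_nat (lookup e l) - of_nat (lookup b l))"
    using assms by (simp add: prod.distrib ffact_def)
  finally show ?thesis by simp
qed

text \<open>
  The character of the exponent vectors by which the substitution
  $x_l \mapsto \xi^{g_l} x_l$ ($1 \le l \le n$) acts on monomials; the variable $x_0$ is fixed.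
\<close>

definition root_char :: "nat \<Rightarrow> complex \<Rightarrow> (nat \<Rightarrow> nat) \<Rightarrow> (nat \<Rightarrow>\<^sub>0 nat) \<Rightarrow> complex" where
  "root_char n \<xi> g e = (\<Prod>l=1..n. \<xi> ^ (g l * lookup e l))"

lemma root_char_add: "root_char n \<xi> g (a + b) = root_char n \<xi> g a * root_char n \<xi> g b"
  by (simp add: root_char_def lookup_add algebra_simps power_add prod.distrib)

lemma root_char_plus: "root_char n \<xi> (\<lambda>l. g l + h l) e = root_char n \<xi> g e * root_char n \<xi> h e"
  by (simp add: root_char_def algebra_simps power_add prod.distrib)

lemma root_char_zero [simp]: "root_char n \<xi> (\<lambda>l. 0) e = 1"
  by (simp add: root_char_def)

lemma root_char_nonzero: "\<xi> \<noteq> 0 \<Longrightarrow> root_char n \<xi> g e \<noteq> 0"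
  by (simp add: root_char_def)

lemma root_char_single: "root_char n \<xi> g (single l c) = (if l \<in> {1..n} then \<xi> ^ (g l * c) else 1)"
proof -
  have "root_char n \<xi> g (single l c) = (\<Prod>m=1..n. if m = l then \<xi> ^ (g l * c) else 1)"
    unfolding root_char_def by (intro prod.cong) (auto simp: lookup_single)
  then show ?thesis by simp
qed

lemma lin_form_eq_sum: "lin_form n \<xi> g = (\<Sum>l\<le>n. single (single l 1) (root_char n \<xi> g (single l 1)))"
proof -
  have "{..n} = insert 0 {1..n}" by auto
  then have "(\<Sum>l\<le>n. single (single l 1) (root_char n \<xi> g (single l 1))) =
      single (single 0 1) 1 + (\<Sum>l=1..n. single (single l 1) (root_char n \<xi> g (single l 1)))"
    by (simp add: root_char_single)
  also have "(\<Sum>l=1..n. single (single l 1) (root_char n \<xi> g (single l 1))) =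
      (\<Sum>l=1..n. pconst (\<xi> ^ g l) * pvar l)"
    by (intro sum.cong) (auto simp: pconst_def pvar_def mult_single root_char_single)
  finally show ?thesis by (simp add: lin_form_def pvar_def)
qed

text \<open>The multinomial theorem for a power of a linear form.\<close>

lemma lookup_lin_form_power:
  "lookup (lin_form n \<xi> g ^ D) e = (if e \<in> exps n D then fact D * root_char n \<xi> g e / efact n e else 0)"
proof (induction D arbitrary: e)
  case 0
  have "e \<in> exps n 0 \<longleftrightarrow> e = 0"
    by (auto simp: exps_def mon_degree_def in_keys_iff intro!: poly_mapping_eqI)
  then show ?case by (auto simp: lookup_one root_char_def efact_def when_def)
next
  case (Suc D)
  let ?c = "\<lambda>l. root_char n \<xi> g (single l 1)"
  have step: "lookup (single (single l 1) (?c l) * lin_form n \<xi> g ^ D) e =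
      (if e \<in> exps n (Suc D) then of_nat (lookup e l) * (fact D * root_char n \<xi> g e / efact n e) else 0)"
    if l: "l \<le> n" for l
  proof (cases "lookup e l = 0")
    case True
    then have "e \<noteq> single l 1 + e'" for e' by (auto simp: lookup_add)
    then show ?thesis using True by (simp add: lookup_single_times_eq_0)
  next
    case False
    then obtain e' where e: "e = single l 1 + e'"
      using exponent_split[of "single l 1" e] by (metis One_nat_def Suc_leI le0 lookup_single_eq
          lookup_single_not_eq neq0_conv)
    have f: "efact n e = of_nat (lookup e l) * efact n e'"
      using efact_add[of n "single l 1" e'] ffact_add_single[OF l, of 0 e] by (simp add: e)
    show ?thesis using l f False
      by (simp add: e lookup_single_times_add Suc.IH add_in_exps_iff mon_degree_single root_char_add)
  qed
  have "lookup (lin_form n \<xi> g ^ Suc D) e =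
      (\<Sum>l\<le>n. lookup (single (single l 1) (?c l) * lin_form n \<xi> g ^ D) e)"
    by (simp add: lin_form_eq_sum sum_distrib_right lookup_sum)
  also have "\<dots> = (if e \<in> exps n (Suc D)
      then of_nat (\<Sum>l\<le>n. lookup e l) * (fact D * root_char n \<xi> g e / efact n e) else 0)"
    by (cases "e \<in> exps n (Suc D)")
      (simp_all add: step[unfolded One_nat_def] sum_distrib_right sum_divide_distrib)
  also have "\<dots> = (if e \<in> exps n (Suc D) then fact (Suc D) * root_char n \<xi> g e / efact n e else 0)"
    by (auto simp: exps_degree)
  finally show ?case .
qed

text \<open>
  The coefficients of a monomial multiple of a power of a linear form: a character times a falling
  factorial. Where the monomial does not divide, both sides are zero.
\<close>

lemma efact_times_lookup:
  assumes b: "keys b \<subseteq> {0..n}" and e: "e \<in> exps n (D + mon_degree b)" and \<xi>: "\<xi> \<noteq> 0"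
  shows "efact n e * lookup (single b 1 * lin_form n \<xi> g ^ D) e
    = fact D / root_char n \<xi> g b * (root_char n \<xi> g e * ffact n b e)"
proof (cases "\<exists>e'. e = b + e'")
  case True
  then obtain e' where e': "e = b + e'" by blast
  show ?thesis using e b root_char_nonzero[OF \<xi>, of n g b]
    by (simp add: e' lookup_single_times_add lookup_lin_form_power add_in_exps_iff efact_add root_char_add)
next
  case False
  then show ?thesis using ffact_eq_0[OF b, of e] by (simp add: lookup_single_times_eq_0)
qed

section \<open>Quasi-polynomials\<close>

text \<open>
  Quasi-polynomials of degree at most \<open>m\<close>: combinations of the characters \<open>root_char n \<xi> g\<close> whose
  coefficients are polynomials of degree at most \<open>m\<close> in the coordinates \<open>1, \<dots>, n\<close>. If \<open>\<xi>\<close> is a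
  primitive \<open>k\<close>-th root of unity, the characters span all functions of the residues of these
  coordinates modulo \<open>k\<close>. The coordinate \<open>0\<close> never enters.
\<close>

inductive quasi_poly :: "nat \<Rightarrow> complex \<Rightarrow> nat \<Rightarrow> ((nat \<Rightarrow>\<^sub>0 nat) \<Rightarrow> complex) \<Rightarrow> bool" for n \<xi> where
  quasi_poly_root_char: "quasi_poly n \<xi> m (\<lambda>e. c * root_char n \<xi> g e)"
| quasi_poly_add: "quasi_poly n \<xi> m f \<Longrightarrow> quasi_poly n \<xi> m f' \<Longrightarrow> quasi_poly n \<xi> m (\<lambda>e. f e + f' e)"
| quasi_poly_coord: "quasi_poly n \<xi> m f \<Longrightarrow> l \<in> {1..n} \<Longrightarrow>
    quasi_poly n \<xi> (Suc m) (\<lambda>e. of_nat (lookup e l) * f e)"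

lemma quasi_poly_mono_add: "quasi_poly n \<xi> m f \<Longrightarrow> quasi_poly n \<xi> (m + r) f"
  by (induction rule: quasi_poly.induct) (auto intro: quasi_poly.intros)

lemma quasi_poly_mono: "quasi_poly n \<xi> m f \<Longrightarrow> m \<le> m' \<Longrightarrow> quasi_poly n \<xi> m' f"
  using quasi_poly_mono_add[of n \<xi> m f "m' - m"] by simp

lemma quasi_poly_const: "quasi_poly n \<xi> m (\<lambda>e. c)"
  using quasi_poly_root_char[of n \<xi> m c "\<lambda>l. 0"] by simp

lemma quasi_poly_root_char_mult:
  assumes "quasi_poly n \<xi> m f"
  shows "quasi_poly n \<xi> m (\<lambda>e. c * root_char n \<xi> g e * f e)"
  using assms
proof induction
  case (quasi_poly_root_char m c' g')
  have "(\<lambda>e. c * root_char n \<xi> g e * (c' * root_char n \<xi> g' e)) = (\<lambda>e. (c * c') * root_char n \<xi> (\<lambda>l. g l + g' l) e)"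
    by (simp add: root_char_plus algebra_simps fun_eq_iff)
  then show ?case using quasi_poly.quasi_poly_root_char[of n \<xi> m "c * c'"] by metis
next
  case (quasi_poly_add m f f')
  then show ?case using quasi_poly.quasi_poly_add by (simp add: distrib_left)
next
  case (quasi_poly_coord m f l)
  then show ?case using quasi_poly.quasi_poly_coord[OF quasi_poly_coord.IH quasi_poly_coord.hyps(2)]
    by (simp add: algebra_simps)
qed

lemma quasi_poly_mult:
  assumes "quasi_poly n \<xi> m f" "quasi_poly n \<xi> m' f'"
  shows "quasi_poly n \<xi> (m + m') (\<lambda>e. f e * f' e)"
  using assms
proof (induction)
  case (quasi_poly_root_char m c g)
  then show ?case using quasi_poly_mono[OF quasi_poly_root_char_mult, of n \<xi> m' f' "m + m'"] by simp
next
  case (quasi_poly_add m f f'')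
  then show ?case using quasi_poly.quasi_poly_add by (simp add: distrib_right)
next
  case (quasi_poly_coord m f l)
  then show ?case using quasi_poly.quasi_poly_coord[OF quasi_poly_coord.IH quasi_poly_coord.hyps(2)]
    by (simp add: algebra_simps)
qed

lemma quasi_poly_scale: "quasi_poly n \<xi> m f \<Longrightarrow> quasi_poly n \<xi> m (\<lambda>e. c * f e)"
  using quasi_poly_mult[OF quasi_poly_const, of n \<xi> m f 0 c] by simp

lemma quasi_poly_diff: "quasi_poly n \<xi> m f \<Longrightarrow> quasi_poly n \<xi> m f' \<Longrightarrow> quasi_poly n \<xi> m (\<lambda>e. f e - f' e)"
  using quasi_poly_add[OF _ quasi_poly_scale, of n \<xi> m f f' "-1"] by simp

lemma quasi_poly_sum:
  assumes "\<And>x. x \<in> A \<Longrightarrow> quasi_poly n \<xi> m (f x)"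
  shows "quasi_poly n \<xi> m (\<lambda>e. \<Sum>x\<in>A. f x e)"
  using assms
  by (induction A rule: infinite_finite_induct) (auto intro: quasi_poly_const quasi_poly_add)

lemma quasi_poly_prod:
  assumes "\<And>x. x \<in> A \<Longrightarrow> quasi_poly n \<xi> (m x) (f x)"
  shows "quasi_poly n \<xi> (\<Sum>x\<in>A. m x) (\<lambda>e. \<Prod>x\<in>A. f x e)"
  using assms
  by (induction A rule: infinite_finite_induct) (auto intro: quasi_poly_const quasi_poly_mult)

lemma quasi_poly_lookup: "l \<in> {1..n} \<Longrightarrow> quasi_poly n \<xi> 1 (\<lambda>e. of_nat (lookup e l))"
  using quasi_poly_coord[OF quasi_poly_const, of l n \<xi> 0 1] by simp

lemma quasi_poly_cong_coords:
  assumes "quasi_poly n \<xi> m f" "\<And>l. l \<in> {1..n} \<Longrightarrow> lookup e l = lookup e' l"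
  shows "f e = f e'"
  using assms by induction (auto simp: root_char_def)

section \<open>Residue classes as quasi-polynomials\<close>

lemma primitive_root_of_unity_power_mod:
  assumes "primitive_root_of_unity k \<xi>"
  shows "\<xi> ^ (m mod k) = \<xi> ^ m"
proof -
  have "\<xi> ^ m = \<xi> ^ (k * (m div k) + m mod k)" by simp
  also have "\<dots> = \<xi> ^ (m mod k)"
    unfolding power_add power_mult using assms by (simp add: primitive_root_of_unity_def)
  finally show ?thesis by simp
qed

lemma sum_powers_primitive_root:
  assumes \<xi>: "primitive_root_of_unity k \<xi>" and k: "k > 0"
  shows "(\<Sum>t<k. \<xi> ^ (t * m)) = (if k dvd m then of_nat k else 0)"
proof (cases "k dvd m")
  case True
  then obtain q where "m = k * q" by blast
  then have "\<xi> ^ (t * m) = 1" for t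
    using \<xi> by (simp add: primitive_root_of_unity_def mult.left_commute[of t] power_mult)
  then show ?thesis using True by simp
next
  case False
  then have "\<xi> ^ (m mod k) \<noteq> 1"
    using \<xi> k by (auto simp: primitive_root_of_unity_def dvd_eq_mod_eq_0)
  then have ne: "\<xi> ^ m \<noteq> 1" using primitive_root_of_unity_power_mod[OF \<xi>] by simp
  have "(\<Sum>t<k. \<xi> ^ (t * m)) = (\<Sum>t<k. (\<xi> ^ m) ^ t)"
    by (simp add: power_mult[symmetric] mult.commute)
  also have "\<dots> = ((\<xi> ^ m) ^ k - 1) / (\<xi> ^ m - 1)"
    using geometric_sum[OF ne] by simp
  also have "(\<xi> ^ m) ^ k = (\<xi> ^ k) ^ m" by (simp add: power_mult[symmetric] mult.commute)
  finally show ?thesis using False \<xi> by (simp add: primitive_root_of_unity_def)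
qed

text \<open>The indicator of a residue is a combination of characters, by finite Fourier inversion.\<close>

lemma quasi_poly_residue:
  assumes \<xi>: "primitive_root_of_unity k \<xi>" and k: "k > 0" and l: "l \<in> {1..n}" and r: "r < k"
  shows "quasi_poly n \<xi> 0 (\<lambda>e. of_bool (lookup e l mod k = r))"
proof -
  let ?g = "\<lambda>t m. if m = l then t else (0::nat)"
  have root_char: "root_char n \<xi> (?g t) e = \<xi> ^ (t * lookup e l)" for t e
  proof -
    have "root_char n \<xi> (?g t) e = (\<Prod>m=1..n. if m = l then \<xi> ^ (t * lookup e l) else 1)"
      unfolding root_char_def by (intro prod.cong) auto
    then show ?thesis using l by simp
  qed
  have "k dvd lookup e l + (k - r) \<longleftrightarrow> lookup e l mod k = r" for e
  proof -
    have "k dvd lookup e l + (k - r) \<longleftrightarrow> (int k dvd int (lookup e l) - int r + int k)"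
      using r by (subst int_dvd_int_iff[symmetric]) (simp add: of_nat_diff algebra_simps)
    also have "\<dots> \<longleftrightarrow> int (lookup e l) mod int k = int r mod int k"
      by (simp add: mod_eq_dvd_iff)
    also have "\<dots> \<longleftrightarrow> lookup e l mod k = r"
      using r by (metis mod_less of_nat_eq_iff of_nat_mod)
    finally show ?thesis .
  qed
  then have "(\<lambda>e. of_bool (lookup e l mod k = r))
    = (\<lambda>e. \<Sum>t<k. (\<xi> ^ (t * (k - r)) / of_nat k) * root_char n \<xi> (?g t) e)"
    using sum_powers_primitive_root[OF \<xi> k, of "lookup e l + (k - r)" for e] k
    unfolding root_char
    by (auto simp: fun_eq_iff algebra_simps power_add sum_divide_distrib[symmetric])
  then show ?thesis by (simp only:) (intro quasi_poly_sum quasi_poly_root_char)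
qed

text \<open>The quotient by \<open>k\<close> is \<open>1/k\<close> times the difference between the coordinate and its residue.\<close>

lemma quasi_poly_div:
  assumes \<xi>: "primitive_root_of_unity k \<xi>" and k: "k > 0" and l: "l \<in> {1..n}"
  shows "quasi_poly n \<xi> 1 (\<lambda>e. of_nat (lookup e l div k))"
proof -
  have "quasi_poly n \<xi> 0 (\<lambda>e. \<Sum>r<k. of_nat r * of_bool (lookup e l mod k = r))"
    by (intro quasi_poly_sum quasi_poly_scale quasi_poly_residue[OF \<xi> k l]) simp
  also have "(\<lambda>e. \<Sum>r<k. of_nat r * of_bool (lookup e l mod k = r)) =
      (\<lambda>e. of_nat (lookup e l mod k) :: complex)"
    using k by (simp add: fun_eq_iff of_bool_def if_distrib[of "\<lambda>x. _ * x"] cong: if_cong)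
  finally have "quasi_poly n \<xi> 1 (\<lambda>e. of_nat (lookup e l mod k))" by (rule quasi_poly_mono) simp
  then have "quasi_poly n \<xi> 1 (\<lambda>e. 1 / of_nat k * (of_nat (lookup e l) - of_nat (lookup e l mod k)))"
    by (intro quasi_poly_scale quasi_poly_diff quasi_poly_lookup l)
  also have "(\<lambda>e. 1 / of_nat k * (of_nat (lookup e l) - of_nat (lookup e l mod k))) =
      (\<lambda>e. of_nat (lookup e l div k) :: complex)"
  proof
    fix e
    have "(of_nat (k * (lookup e l div k) + lookup e l mod k) :: complex) - of_nat (lookup e l mod k)
        = of_nat k * of_nat (lookup e l div k)"
      by (simp only: of_nat_add of_nat_mult add_diff_cancel_right')
    then have "(of_nat (lookup e l) :: complex) - of_nat (lookup e l mod k) =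
        of_nat k * of_nat (lookup e l div k)"
      by (simp only: mult_div_mod_eq)
    then show "1 / of_nat k * (of_nat (lookup e l) - of_nat (lookup e l mod k)) =
        (of_nat (lookup e l div k) :: complex)"
      using k by (simp only:) simp
  qed
  finally show ?thesis .
qed

text \<open>Agreement modulo \<open>k\<close> in the coordinates \<open>1, \<dots>, n\<close>; the coordinate \<open>0\<close> is free.\<close>

definition same_residues :: "nat \<Rightarrow> nat \<Rightarrow> (nat \<Rightarrow>\<^sub>0 nat) \<Rightarrow> (nat \<Rightarrow>\<^sub>0 nat) \<Rightarrow> bool" where
  "same_residues n k e e' \<longleftrightarrow> (\<forall>l\<in>{1..n}. lookup e l mod k = lookup e' l mod k)"

text \<open>The sum of the quotients by \<open>k\<close> of the coordinates \<open>1, \<dots>, n\<close>.\<close>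

definition quot_deg :: "nat \<Rightarrow> nat \<Rightarrow> (nat \<Rightarrow>\<^sub>0 nat) \<Rightarrow> nat" where
  "quot_deg n k e = (\<Sum>l=1..n. lookup e l div k)"

lemma quasi_poly_same_residues:
  assumes \<xi>: "primitive_root_of_unity k \<xi>" and k: "k > 0"
  shows "quasi_poly n \<xi> 0 (\<lambda>e. of_bool (same_residues n k e e0))"
proof -
  have "quasi_poly n \<xi> (\<Sum>l\<in>{1..n}. 0)
      (\<lambda>e. \<Prod>l=1..n. of_bool (lookup e l mod k = lookup e0 l mod k))"
    by (intro quasi_poly_prod quasi_poly_residue[OF \<xi> k]) (use k in auto)
  also have "(\<lambda>e. \<Prod>l=1..n. of_bool (lookup e l mod k = lookup e0 l mod k) :: complex) =
      (\<lambda>e. of_bool (same_residues n k e e0))"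
    by (auto simp: fun_eq_iff same_residues_def of_bool_def intro!: prod.neutral)
  finally show ?thesis by simp
qed

text \<open>
  The element of the Newton basis belonging to \<open>e0\<close>: on the residue class of \<open>e0\<close> it is a product of
  falling factorials of the quotients of the coordinates by \<open>k\<close>, and it is zero elsewhere. It does
  not vanish at \<open>e0\<close> and is triangular with respect to \<open>quot_deg\<close>.
\<close>

definition newton :: "nat \<Rightarrow> nat \<Rightarrow> (nat \<Rightarrow>\<^sub>0 nat) \<Rightarrow> (nat \<Rightarrow>\<^sub>0 nat) \<Rightarrow> complex" where
  "newton n k e0 e = of_bool (same_residues n k e e0) *
     (\<Prod>l=1..n. \<Prod>r<lookup e0 l div k. of_nat (lookup e l div k) - of_nat r)"

lemma quasi_poly_newton:
  assumes \<xi>: "primitive_root_of_unity k \<xi>" and k: "k > 0"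
  shows "quasi_poly n \<xi> (quot_deg n k e0) (newton n k e0)"
proof -
  have "quasi_poly n \<xi> (0 + (\<Sum>l=1..n. \<Sum>r<lookup e0 l div k. 1)) (newton n k e0)"
    unfolding newton_def
    by (intro quasi_poly_mult quasi_poly_same_residues[OF \<xi> k] quasi_poly_prod quasi_poly_diff
        quasi_poly_div[OF \<xi> k] quasi_poly_const) auto
  then show ?thesis by (simp add: quot_deg_def)
qed

lemma newton_self: "newton n k e0 e0 \<noteq> 0"
  by (auto simp: newton_def same_residues_def)

lemma newton_nonzeroD:
  assumes "newton n k e0 e \<noteq> 0" and e: "e \<in> exps n i" "e0 \<in> exps n i"
  shows "e = e0 \<or> quot_deg n k e > quot_deg n k e0"
proof -
  have res: "lookup e l mod k = lookup e0 l mod k" if "l \<in> {1..n}" for l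
    using assms(1) that by (auto simp: newton_def same_residues_def split: if_splits)
  have le: "lookup e0 l div k \<le> lookup e l div k" if l: "l \<in> {1..n}" for l
  proof (rule ccontr)
    assume "\<not> ?thesis"
    then have "(\<Prod>r<lookup e0 l div k. (of_nat (lookup e l div k) :: complex) - of_nat r) = 0"
      by (intro prod_zero) auto
    then have "newton n k e0 e = 0" unfolding newton_def using l by auto
    then show False using assms(1) by contradiction
  qed
  show ?thesis
  proof (cases "\<exists>l\<in>{1..n}. lookup e0 l div k < lookup e l div k")
    case True
    then show ?thesis unfolding quot_deg_def by (intro disjI2 sum_strict_mono_ex1) (auto simp: le)
  next
    case False
    have eq: "lookup e l = lookup e0 l" if "l \<in> {1..n}" for l
    proof -
      have "\<not> lookup e0 l div k < lookup e l div k" using False that by blast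
      then have "lookup e l div k = lookup e0 l div k" using le[OF that] by linarith
      with res[OF that] show ?thesis by (metis div_mult_mod_eq)
    qed
    have s: "{..n} = insert 0 {1..n}" by auto
    have "lookup e 0 = lookup e0 0"
      using exps_degree[OF e(1)] exps_degree[OF e(2)] eq by (simp add: s)
    have "e = e0"
    proof (rule poly_mapping_eqI)
      fix l
      consider "l = 0" | "l \<in> {1..n}" | "l \<notin> {0..n}" by fastforce
      then show "lookup e l = lookup e0 l"
      proof cases
        case 3
        then have "l \<notin> keys e" "l \<notin> keys e0" using e by (auto simp: exps_def)
        then show ?thesis by (simp add: in_keys_iff)
      qed (use eq \<open>lookup e 0 = lookup e0 0\<close> in auto)
    qed
    then show ?thesis ..
  qed
qed

section \<open>Finite differences\<close>

text \<open>
  All \<open>m\<close>-fold differences of \<open>f\<close> with step \<open>k\<close> in the directions \<open>1, \<dots>, n\<close> are zero; for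
  \<open>m = 0\<close> this says that \<open>f\<close> itself is zero. Steps of length \<open>k\<close> stay in a residue class and do
  not change the characters.
\<close>

fun differences_vanish :: "nat \<Rightarrow> nat \<Rightarrow> nat \<Rightarrow> ((nat \<Rightarrow>\<^sub>0 nat) \<Rightarrow> complex) \<Rightarrow> bool" where
  "differences_vanish n k 0 f \<longleftrightarrow> (\<forall>e. f e = 0)"
| "differences_vanish n k (Suc m) f \<longleftrightarrow> (\<forall>l\<in>{1..n}. differences_vanish n k m (\<lambda>e. f (e + single l k) - f e))"

lemma differences_vanish_zero: "differences_vanish n k m (\<lambda>e. 0)"
  by (induction m) auto

lemma differences_vanish_add:
  "differences_vanish n k m f \<Longrightarrow> differences_vanish n k m f' \<Longrightarrow> differences_vanish n k m (\<lambda>e. f e + f' e)"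
proof (induction m arbitrary: f f')
  case (Suc m)
  have "differences_vanish n k m (\<lambda>e. (f (e + single l k) - f e) + (f' (e + single l k) - f' e))"
    if "l \<in> {1..n}" for l
    using Suc that by (intro Suc.IH) auto
  then show ?case by (simp add: algebra_simps)
qed simp

lemma differences_vanish_scale: "differences_vanish n k m f \<Longrightarrow> differences_vanish n k m (\<lambda>e. c * f e)"
proof (induction m arbitrary: f)
  case (Suc m)
  have "differences_vanish n k m (\<lambda>e. c * (f (e + single l k) - f e))" if "l \<in> {1..n}" for l
    using Suc that by (intro Suc.IH) auto
  then show ?case by (simp add: algebra_simps)
qed simp

text \<open>
  A discrete Leibniz rule: a factor that is affine along the steps costs one more difference.
\<close>

lemma differences_vanish_affine_mult:
  assumes "differences_vanish n k m f" "\<And>e l. l \<in> {1..n} \<Longrightarrow> L (e + single l k) = L e + c l"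
  shows "differences_vanish n k (Suc m) (\<lambda>e. L e * f e)"
  using assms
proof (induction m arbitrary: f L)
  case 0 then show ?case by simp
next
  case (Suc m)
  have "differences_vanish n k (Suc m) (\<lambda>e. L (e + single l k) * f (e + single l k) - L e * f e)"
    if l: "l \<in> {1..n}" for l
  proof -
    have "differences_vanish n k (Suc m) (\<lambda>e. (L e + c l) * (f (e + single l k) - f e) + c l * f e)"
    proof (intro differences_vanish_add differences_vanish_scale)
      show "differences_vanish n k (Suc m) (\<lambda>e. (L e + c l) * (f (e + single l k) - f e))"
        using Suc.prems l by (intro Suc.IH) auto
    qed (rule Suc.prems)
    then show ?thesis using Suc.prems(2)[OF l] by (simp add: algebra_simps)
  qed
  then show ?case by (simp only: differences_vanish.simps(2)) blast
qed

lemma quasi_poly_differences_vanish: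
  assumes "quasi_poly n \<xi> m f" and \<xi>: "\<xi> ^ k = 1"
  shows "differences_vanish n k (Suc m) f"
  using assms(1)
proof induction
  case (quasi_poly_root_char m c g)
  have "root_char n \<xi> g (e + single l k) = root_char n \<xi> g e" for l e
    using \<xi> by (auto simp: root_char_add root_char_single mult.commute[of _ k] power_mult)
  then show ?case by (simp add: differences_vanish_zero)
next
  case (quasi_poly_add m f f')
  then show ?case by (intro differences_vanish_add)
next
  case (quasi_poly_coord m f l)
  show ?case
    by (rule differences_vanish_affine_mult[where c = "\<lambda>l'. if l' = l then of_nat k else 0"])
      (use quasi_poly_coord in \<open>auto simp: lookup_add lookup_single\<close>)
qed

lemma quot_deg_add_single:
  assumes "l \<in> {1..n}" "k > 0"
  shows "quot_deg n k (e + single l k) = Suc (quot_deg n k e)"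
proof -
  have "quot_deg n k (e + single l k) = (\<Sum>m=1..n. lookup e m div k + (if m = l then 1 else 0))"
    unfolding quot_deg_def using assms(2)
    by (intro sum.cong) (auto simp: lookup_add lookup_single)
  then show ?thesis using assms by (simp add: sum.distrib quot_deg_def)
qed

text \<open>
  Uniqueness of interpolation on a simplex: by induction the first differences of \<open>f\<close> are zero, so
  \<open>f\<close> is constant on each residue class, and the class contains a point with all quotients zero.
\<close>

lemma differences_vanish_unique:
  assumes k: "k > 0" and "differences_vanish n k m f" "\<And>e. quot_deg n k e < m \<Longrightarrow> f e = 0"
  shows "f e = 0"
  using assms(2-)
proof (induction m arbitrary: f e)
  case (Suc m)
  have step: "f (e + single l k) = f e" if l: "l \<in> {1..n}" for l e
    using Suc.IH[of "\<lambda>e. f (e + single l k) - f e" e] Suc.prems l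
    by (simp add: quot_deg_add_single[OF l k])
  show ?case
  proof (induction "quot_deg n k e" arbitrary: e)
    case 0
    then show ?case using Suc.prems(2) by simp
  next
    case (Suc q)
    then have "quot_deg n k e \<noteq> 0" by simp
    then obtain l where l: "l \<in> {1..n}" "lookup e l div k \<noteq> 0"
      unfolding quot_deg_def by (metis sum.neutral)
    then have "k \<le> lookup e l" using k by (metis div_less not_less)
    then obtain e' where e: "e = single l k + e'"
      using exponent_split[of "single l k" e] by (metis le0 lookup_single_eq lookup_single_not_eq)
    then have "e = e' + single l k" by (simp add: add.commute)
    moreover from this have "f e' = 0"
      using Suc.hyps quot_deg_add_single[OF l(1) k, of e'] by (metis Suc_inject)
    ultimately show ?case using step[OF l(1)] by simp
  qed
qed simp

section \<open>The graded pieces of the ideal\<close>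

lemma poly_ring_simps [simp]:
  "p \<otimes>\<^bsub>poly_ring n\<^esub> q = p * q" "p \<oplus>\<^bsub>poly_ring n\<^esub> q = p + q"
  "\<one>\<^bsub>poly_ring n\<^esub> = 1" "\<zero>\<^bsub>poly_ring n\<^esub> = 0"
  by (simp_all add: poly_ring_def)

lemma poly_ring_carrier_iff:
  "p \<in> carrier (poly_ring n) \<longleftrightarrow> (\<forall>e \<in> keys p. keys e \<subseteq> {0..n})"
  by (simp add: poly_ring_def)

lemma poly_ring_closed_add:
  "p \<in> carrier (poly_ring n) \<Longrightarrow> q \<in> carrier (poly_ring n) \<Longrightarrow> p + q \<in> carrier (poly_ring n)"
  using keys_add[of p q] by (auto simp: poly_ring_carrier_iff)

lemma poly_ring_closed_mult:
  "p \<in> carrier (poly_ring n) \<Longrightarrow> q \<in> carrier (poly_ring n) \<Longrightarrow> p * q \<in> carrier (poly_ring n)"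
  unfolding poly_ring_carrier_iff
proof
  fix e assume p: "\<forall>e\<in>keys p. keys e \<subseteq> {0..n}" and q: "\<forall>e\<in>keys q. keys e \<subseteq> {0..n}"
    and "e \<in> keys (p * q)"
  then obtain a b where "e = a + b" "a \<in> keys p" "b \<in> keys q" using keys_mult[of p q] by blast
  then show "keys e \<subseteq> {0..n}" using p q by (simp add: keys_add_nat)
qed

lemma cring_poly_ring: "cring (poly_ring n)"
proof (rule cringI)
  show "abelian_group (poly_ring n)"
  proof (rule abelian_groupI)
    fix p assume "p \<in> carrier (poly_ring n)"
    then have "- p \<in> carrier (poly_ring n)" by (auto simp: poly_ring_carrier_iff in_keys_iff)
    then show "\<exists>q\<in>carrier (poly_ring n). q \<oplus>\<^bsub>poly_ring n\<^esub> p = \<zero>\<^bsub>poly_ring n\<^esub>"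
      by (intro bexI[of _ "- p"]) auto
  qed (auto simp: poly_ring_closed_add algebra_simps, simp add: poly_ring_carrier_iff)
  show "Group.comm_monoid (poly_ring n)"
    by (rule comm_monoidI)
      (simp_all add: poly_ring_closed_mult algebra_simps, simp add: poly_ring_carrier_iff)
qed (simp add: algebra_simps)

lemma poly_ring_minus:
  assumes "p \<in> carrier (poly_ring n)" "q \<in> carrier (poly_ring n)"
  shows "p \<ominus>\<^bsub>poly_ring n\<^esub> q = p - q"
proof -
  interpret cring "poly_ring n" by (rule cring_poly_ring)
  have m: "- q \<in> carrier (poly_ring n)" using assms by (auto simp: poly_ring_carrier_iff in_keys_iff)
  have "\<ominus>\<^bsub>poly_ring n\<^esub> q = - q"
    by (rule minus_equality) (use m assms in auto)
  then show ?thesis by (simp add: a_minus_def)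
qed

lemma pconst_carrier: "pconst c \<in> carrier (poly_ring n)"
  by (auto simp: poly_ring_carrier_iff pconst_def)

lemma single_carrier: "keys b \<subseteq> {0..n} \<Longrightarrow> single b c \<in> carrier (poly_ring n)"
  by (auto simp: poly_ring_carrier_iff)

lemma lookup_pconst_mult: "lookup (pconst c * q) e = c * lookup q e"
  using lookup_single_times_add[of 0 c q e] by (simp add: pconst_def)

lemma homogeneous_part_iff: "p \<in> homogeneous_part n i \<longleftrightarrow> keys p \<subseteq> exps n i"
  by (auto simp: homogeneous_part_def poly_ring_carrier_iff exps_def)

lemma lin_form_power_carrier: "lin_form n \<xi> g ^ D \<in> carrier (poly_ring n)"
  unfolding poly_ring_carrier_iff
proof
  fix e assume "e \<in> keys (lin_form n \<xi> g ^ D)"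
  then have "e \<in> exps n D" by (auto simp: in_keys_iff lookup_lin_form_power split: if_splits)
  then show "keys e \<subseteq> {0..n}" by (simp add: exps_def)
qed

text \<open>
  The form of degree \<open>i\<close> whose coefficients, multiplied by the factorials of the exponents,
  are the values of \<open>f\<close>.
\<close>

definition dp_form :: "nat \<Rightarrow> nat \<Rightarrow> ((nat \<Rightarrow>\<^sub>0 nat) \<Rightarrow> complex) \<Rightarrow> cpoly" where
  "dp_form n i f = (\<Sum>e\<in>exps n i. single e (f e / efact n e))"

lemma lookup_dp_form: "lookup (dp_form n i f) e = (if e \<in> exps n i then f e / efact n e else 0)"
proof -
  have "lookup (dp_form n i f) e = (\<Sum>e'\<in>exps n i. if e' = e then f e / efact n e else 0)"
    unfolding dp_form_def lookup_sum by (intro sum.cong) (auto simp: lookup_single)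
  then show ?thesis by (simp add: finite_exps)
qed

lemma dp_form_add: "dp_form n i (\<lambda>e. f e + f' e) = dp_form n i f + dp_form n i f'"
  by (rule poly_mapping_eqI) (simp add: lookup_dp_form lookup_add add_divide_distrib)

lemma dp_form_scale: "dp_form n i (\<lambda>e. c * f e) = pconst c * dp_form n i f"
  by (rule poly_mapping_eqI) (simp add: lookup_dp_form lookup_pconst_mult)

lemma dp_form_sum: "dp_form n i (\<lambda>e. \<Sum>x\<in>A. f x e) = (\<Sum>x\<in>A. dp_form n i (f x))"
  by (rule poly_mapping_eqI) (simp add: lookup_dp_form lookup_sum sum_divide_distrib)

lemma dp_form_cong: "(\<And>e. e \<in> exps n i \<Longrightarrow> f e = f' e) \<Longrightarrow> dp_form n i f = dp_form n i f'"
  by (simp add: dp_form_def)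

text \<open>
  The data of the problem. The degree of the generators is \<open>D\<close> below, and \<open>j\<close> is the excess over
  \<open>D\<close> of the degree under consideration.
\<close>

locale power_ideal =
  fixes n k d j :: nat and \<xi> :: complex
  assumes k: "k > 0" and \<xi>: "primitive_root_of_unity k \<xi>"
begin

definition D :: nat where "D = (k - 1) * d"
abbreviation "I \<equiv> I_ideal n k d \<xi>"

lemma \<xi>_nonzero: "\<xi> \<noteq> 0"
  using \<xi> k by (auto simp: primitive_root_of_unity_def power_0_left)

lemma ideal_I: "ideal I (poly_ring n)"
proof -
  interpret cring "poly_ring n" by (rule cring_poly_ring)
  show ?thesis unfolding I_ideal_def D_def[symmetric] by (rule genideal_ideal) (auto intro: lin_form_power_carrier)
qed

lemma I_zero: "0 \<in> I"
  using additive_subgroup.zero_closed[OF ideal.axioms(1)[OF ideal_I]] by simp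

lemma I_add: "p \<in> I \<Longrightarrow> q \<in> I \<Longrightarrow> p + q \<in> I"
  using additive_subgroup.a_closed[OF ideal.axioms(1)[OF ideal_I], of p q] by simp

lemma I_mult: "p \<in> I \<Longrightarrow> q \<in> carrier (poly_ring n) \<Longrightarrow> q * p \<in> I"
  using ideal.I_l_closed[OF ideal_I, of p q] by simp

lemma I_scale: "p \<in> I \<Longrightarrow> pconst c * p \<in> I"
  by (intro I_mult pconst_carrier)

lemma I_uminus: "p \<in> I \<Longrightarrow> - p \<in> I"
proof -
  have "- p = pconst (- 1) * p" by (rule poly_mapping_eqI) (simp add: lookup_pconst_mult)
  then show "p \<in> I \<Longrightarrow> - p \<in> I" using I_scale by metis
qed

lemma I_sum: "(\<And>x. x \<in> A \<Longrightarrow> f x \<in> I) \<Longrightarrow> (\<Sum>x\<in>A. f x) \<in> I"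
  by (induction A rule: infinite_finite_induct) (auto intro: I_zero I_add)

lemma lin_form_power_in_I: "lin_form n \<xi> g ^ D \<in> I"
proof -
  interpret cring "poly_ring n" by (rule cring_poly_ring)
  \<comment> \<open>The generators have \<open>g l \<le> k - 1\<close>, but only \<open>g l\<close> modulo \<open>k\<close> matters.\<close>
  have "lin_form n \<xi> g = lin_form n \<xi> (\<lambda>l. g l mod k)"
    by (simp add: lin_form_def primitive_root_of_unity_power_mod[OF \<xi>])
  moreover have "g l mod k \<le> k - 1" for l using k by (simp add: Suc_leI less_Suc_eq_le[symmetric])
  ultimately have "lin_form n \<xi> g ^ D
      \<in> {lin_form n \<xi> g ^ D | g. \<forall>l \<in> {1..n}. g l \<le> k - 1}"
    by (intro CollectI exI[of _ "\<lambda>l. g l mod k"]) auto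
  then show ?thesis unfolding I_ideal_def D_def[symmetric]
    by (rule subsetD[OF genideal_self, rotated]) (auto intro: lin_form_power_carrier)
qed

lemma dp_form_root_char_ffact_top:
  assumes b: "keys b \<subseteq> {0..n}" "mon_degree b = j"
  shows "dp_form n (D + j) (\<lambda>e. root_char n \<xi> g e * ffact n b e) \<in> I"
proof -
  have "dp_form n (D + j) (\<lambda>e. root_char n \<xi> g e * ffact n b e) =
      pconst (root_char n \<xi> g b / fact D) * (single b 1 * lin_form n \<xi> g ^ D)"
  proof (rule poly_mapping_eqI)
    fix e
    show "lookup (dp_form n (D + j) (\<lambda>e. root_char n \<xi> g e * ffact n b e)) e =
        lookup (pconst (root_char n \<xi> g b / fact D) * (single b 1 * lin_form n \<xi> g ^ D)) e"
    proof (cases "e \<in> exps n (D + j)")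
      case True
      then show ?thesis
        using efact_times_lookup[OF b(1) _ \<xi>_nonzero, of e D g] b(2) root_char_nonzero[OF \<xi>_nonzero, of n g b]
        unfolding lookup_dp_form lookup_pconst_mult by (simp add: field_simps)
    next
      case False
      have "lookup (single b 1 * lin_form n \<xi> g ^ D) e = 0"
      proof (cases "\<exists>e'. e = b + e'")
        case True
        then show ?thesis using False b
          by (auto simp: lookup_single_times_add lookup_lin_form_power add_in_exps_iff)
      qed (simp add: lookup_single_times_eq_0)
      then show ?thesis using False by (simp add: lookup_dp_form lookup_pconst_mult)
    qed
  qed
  then show ?thesis
    using I_scale[OF I_mult[OF lin_form_power_in_I single_carrier[OF b(1), of 1]]] by simp
qed

text \<open>
  Falling factorials of lower degree: on exponents $e$ of degree $i$,
  $(i - |b|)\,(e)_b = \sum_l (e_l - b_l)(e)_b$ is the sum of the falling factorials of $b$ increased by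
  one in a coordinate $l$, which raises the degree by one until it reaches $j$.
\<close>

lemma dp_form_root_char_ffact:
  assumes "keys b \<subseteq> {0..n}" "mon_degree b \<le> j"
  shows "dp_form n (D + j) (\<lambda>e. root_char n \<xi> g e * ffact n b e) \<in> I"
  using assms
proof (induction "j - mon_degree b" arbitrary: b)
  case 0
  then show ?case by (intro dp_form_root_char_ffact_top) auto
next
  case (Suc m)
  let ?f = "\<lambda>b e. root_char n \<xi> g e * ffact n b e"
  define c :: complex where "c = of_nat (D + j - mon_degree b)"
  have c: "c \<noteq> 0" using Suc.hyps(2) unfolding c_def by (simp del: of_nat_diff)
  have "?f b e = 1 / c * (\<Sum>l\<le>n. ?f (b + single l 1) e)" if e: "e \<in> exps n (D + j)" for e
  proof -
    have "b \<in> exps n (mon_degree b)" using Suc.prems by (simp add: exps_def)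
    then have "(\<Sum>l\<le>n. (of_nat (lookup e l) :: complex) - of_nat (lookup b l)) =
        of_nat (D + j) - of_nat (mon_degree b)"
      using exps_degree[OF e] exps_degree[of b n "mon_degree b"]
      by (simp only: sum_subtractf of_nat_sum[symmetric])
    also have "\<dots> = c" unfolding c_def using Suc.prems(2) by (subst of_nat_diff) auto
    finally have s: "(\<Sum>l\<le>n. (of_nat (lookup e l) :: complex) - of_nat (lookup b l)) = c" .
    have "(\<Sum>l\<le>n. ?f (b + single l 1) e) =
        (\<Sum>l\<le>n. (of_nat (lookup e l) - of_nat (lookup b l)) * ?f b e)"
      by (intro sum.cong refl, subst ffact_add_single) auto
    also have "\<dots> = c * ?f b e" by (simp only: sum_distrib_right[symmetric] s)
    finally show ?thesis using c by simp
  qed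
  then have "dp_form n (D + j) (?f b) =
      pconst (1 / c) * (\<Sum>l\<le>n. dp_form n (D + j) (?f (b + single l 1)))"
    unfolding dp_form_sum[symmetric] dp_form_scale[symmetric] by (rule dp_form_cong)
  also have "\<dots> \<in> I"
  proof (intro I_scale I_sum)
    fix l assume "l \<in> {..n}"
    then show "dp_form n (D + j) (?f (b + single l 1)) \<in> I"
      using Suc.hyps(2) Suc.prems
      by (intro Suc.hyps(1)) (auto simp: keys_add_nat mon_degree_add mon_degree_single)
  qed
  finally show ?case .
qed

text \<open>
  The falling factorial is carried along so that multiplication by a coordinate can be absorbed
  into it.
\<close>

lemma dp_form_quasi_poly_ffact:
  assumes "quasi_poly n \<xi> m f" "keys b \<subseteq> {0..n}" "mon_degree b + m \<le> j"
  shows "dp_form n (D + j) (\<lambda>e. f e * ffact n b e) \<in> I"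
  using assms
proof (induction arbitrary: b)
  case (quasi_poly_root_char m c g)
  then show ?case
    using I_scale[OF dp_form_root_char_ffact[of b g], of c]
    by (simp add: dp_form_scale[symmetric] mult.assoc)
next
  case (quasi_poly_add m f f')
  then show ?case by (simp add: distrib_right dp_form_add I_add)
next
  case (quasi_poly_coord m f l)
  have l: "l \<le> n" using quasi_poly_coord.hyps by auto
  have "(\<lambda>e. of_nat (lookup e l) * f e * ffact n b e) =
      (\<lambda>e. f e * ffact n (b + single l 1) e + of_nat (lookup b l) * (f e * ffact n b e))"
    unfolding ffact_add_single[OF l] by (simp add: algebra_simps fun_eq_iff)
  moreover have "dp_form n (D + j) (\<lambda>e. f e * ffact n (b + single l 1) e) \<in> I"
    using quasi_poly_coord.prems l
    by (intro quasi_poly_coord.IH) (auto simp: keys_add_nat mon_degree_add mon_degree_single)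
  moreover have "dp_form n (D + j) (\<lambda>e. f e * ffact n b e) \<in> I"
    using quasi_poly_coord.prems by (intro quasi_poly_coord.IH) auto
  ultimately show ?case by (simp add: dp_form_add dp_form_scale I_add I_scale)
qed

lemma dp_form_quasi_poly: "quasi_poly n \<xi> j f \<Longrightarrow> dp_form n (D + j) f \<in> I"
  using dp_form_quasi_poly_ffact[of j f 0] by (simp add: mon_degree_def)

text \<open>
  On exponents of degree \<open>i\<close> a falling factorial is a polynomial in the coordinates
  \<open>1, \<dots>, n\<close> alone, because the coordinate \<open>0\<close> equals \<open>i\<close> minus their sum.
\<close>

lemma quasi_poly_ffact:
  assumes b: "keys b \<subseteq> {0..n}"
  shows "\<exists>f. quasi_poly n \<xi> (mon_degree b) f \<and> (\<forall>e\<in>exps n i. ffact n b e = f e)"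
proof -
  let ?x = "\<lambda>e l. if l = 0 then of_nat i - (\<Sum>m=1..n. of_nat (lookup e m)) else of_nat (lookup e l) :: complex"
  have coord: "quasi_poly n \<xi> 1 (\<lambda>e. ?x e l)" if "l \<le> n" for l
  proof (cases "l = 0")
    case True
    then show ?thesis by (simp, intro quasi_poly_diff quasi_poly_const quasi_poly_sum quasi_poly_lookup[unfolded One_nat_def]) auto
  next
    case False
    then show ?thesis using quasi_poly_lookup[of l n \<xi>] that by simp
  qed
  have "quasi_poly n \<xi> (\<Sum>l\<le>n. \<Sum>r<lookup b l. 1) (\<lambda>e. \<Prod>l\<le>n. \<Prod>r<lookup b l. ?x e l - of_nat r)"
    by (intro quasi_poly_prod quasi_poly_diff coord quasi_poly_const) auto
  moreover have "(\<Sum>l\<le>n. \<Sum>r<lookup b l. 1) = mon_degree b"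
    using exps_degree[of b n "mon_degree b"] b by (simp add: exps_def)
  moreover have "ffact n b e = (\<Prod>l\<le>n. \<Prod>r<lookup b l. ?x e l - of_nat r)" if e: "e \<in> exps n i" for e
  proof -
    have s: "{..n} = insert 0 {1..n}" by auto
    have "of_nat i = (of_nat (lookup e 0) :: complex) + (\<Sum>m=1..n. of_nat (lookup e m))"
      using exps_degree[OF e, symmetric] by (simp add: s)
    then show ?thesis by (auto simp: ffact_def intro!: prod.cong)
  qed
  ultimately show ?thesis
    by (intro exI[of _ "\<lambda>e. \<Prod>l\<le>n. \<Prod>r<lookup b l. ?x e l - of_nat r"] conjI ballI) simp_all
qed

text \<open>
  The part of \<open>p\<close> of degree \<open>D + j\<close> is the form of a quasi-polynomial of degree at most \<open>j\<close>; the
  other homogeneous parts of \<open>p\<close> are not restricted.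
\<close>

definition quasi_poly_part :: "cpoly \<Rightarrow> bool" where
  "quasi_poly_part p \<longleftrightarrow>
     (\<exists>f. quasi_poly n \<xi> j f \<and> (\<forall>e\<in>exps n (D + j). efact n e * lookup p e = f e))"

lemma quasi_poly_part_add: "quasi_poly_part p \<Longrightarrow> quasi_poly_part q \<Longrightarrow> quasi_poly_part (p + q)"
  unfolding quasi_poly_part_def lookup_add distrib_left by (metis (no_types, lifting) quasi_poly_add)

lemma quasi_poly_part_0: "quasi_poly_part 0"
  unfolding quasi_poly_part_def using quasi_poly_const[of n \<xi> j 0] by auto

lemma quasi_poly_part_sum: "(\<And>x. x \<in> A \<Longrightarrow> quasi_poly_part (f x)) \<Longrightarrow> quasi_poly_part (\<Sum>x\<in>A. f x)"
  by (induction A rule: infinite_finite_induct) (auto intro: quasi_poly_part_0 quasi_poly_part_add)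

lemma quasi_poly_part_scale: "quasi_poly_part p \<Longrightarrow> quasi_poly_part (pconst c * p)"
  unfolding quasi_poly_part_def lookup_pconst_mult mult.left_commute[of _ c]
  by (metis (no_types, lifting) quasi_poly_scale)

lemma quasi_poly_part_monomial_times_generator:
  assumes b: "keys b \<subseteq> {0..n}"
  shows "quasi_poly_part (single b 1 * lin_form n \<xi> g ^ D)"
proof (cases "mon_degree b = j")
  case True
  obtain f where f: "quasi_poly n \<xi> j f" "\<forall>e\<in>exps n (D + j). ffact n b e = f e"
    using quasi_poly_ffact[OF b] True by metis
  have "efact n e * lookup (single b 1 * lin_form n \<xi> g ^ D) e =
      fact D / root_char n \<xi> g b * root_char n \<xi> g e * f e" if "e \<in> exps n (D + j)" for e
    using efact_times_lookup[OF b _ \<xi>_nonzero, of e D g] that f(2) True by (simp add: mult.assoc)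
  then show ?thesis
    unfolding quasi_poly_part_def using quasi_poly_root_char_mult[OF f(1)] by blast
next
  case False
  have "lookup (single b 1 * lin_form n \<xi> g ^ D) e = 0" if "e \<in> exps n (D + j)" for e
  proof (cases "\<exists>e'. e = b + e'")
    case True
    then obtain e' where e': "e = b + e'" ..
    then have "e' \<notin> exps n D" using that False by (auto simp: exps_def mon_degree_add)
    then show ?thesis by (simp add: e' lookup_single_times_add lookup_lin_form_power)
  qed (simp add: lookup_single_times_eq_0)
  then show ?thesis unfolding quasi_poly_part_def using quasi_poly_const[of n \<xi> j 0] by auto
qed

lemma poly_eq_sum_monomials: "p = (\<Sum>e\<in>keys p. pconst (lookup p e) * single e 1)" for p :: cpoly
proof (rule poly_mapping_eqI)
  fix e
  have "lookup (\<Sum>e\<in>keys p. pconst (lookup p e) * single e 1) e =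
      (\<Sum>e'\<in>keys p. if e' = e then lookup p e else 0)"
    unfolding lookup_sum lookup_pconst_mult by (intro sum.cong) (auto simp: lookup_single)
  then show "lookup p e = lookup (\<Sum>e\<in>keys p. pconst (lookup p e) * single e 1) e"
    by (auto simp: in_keys_iff)
qed

lemma quasi_poly_part_I:
  assumes "p \<in> I"
  shows "quasi_poly_part p"
proof -
  interpret cring "poly_ring n" by (rule cring_poly_ring)
  \<comment> \<open>The condition \<open>quasi_poly_part\<close> alone is not stable under multiplication; asking for it on all
    multiples gives an ideal.\<close>
  define J where "J = {p \<in> carrier (poly_ring n). \<forall>q\<in>carrier (poly_ring n). quasi_poly_part (q * p)}"
  have J: "ideal J (poly_ring n)"
  proof (rule idealI)
    show "subgroup J (add_monoid (poly_ring n))"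
    proof (rule add.subgroupI)
      show "J \<subseteq> carrier (poly_ring n)" by (auto simp: J_def)
      have "0 \<in> J" using zero_closed by (simp add: J_def quasi_poly_part_0)
      then show "J \<noteq> {}" by blast
      fix a assume a: "a \<in> J"
      then have a': "a \<in> carrier (poly_ring n)" by (simp add: J_def)
      then have ma: "- a \<in> carrier (poly_ring n)" by (auto simp: poly_ring_carrier_iff in_keys_iff)
      have "\<ominus>\<^bsub>poly_ring n\<^esub> a = - a"
        by (rule minus_equality) (use a' ma in auto)
      moreover have "quasi_poly_part (q * - a)" if q: "q \<in> carrier (poly_ring n)" for q
      proof -
        have "q * - a = pconst (-1) * (q * a)"
          by (rule poly_mapping_eqI) (simp add: lookup_pconst_mult)
        then show ?thesis using a q quasi_poly_part_scale by (simp add: J_def)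
      qed
      ultimately show "\<ominus>\<^bsub>poly_ring n\<^esub> a \<in> J" using ma by (simp add: J_def)
      fix b assume "b \<in> J"
      then show "a \<oplus>\<^bsub>poly_ring n\<^esub> b \<in> J"
        using a by (simp add: J_def poly_ring_closed_add distrib_left quasi_poly_part_add)
    qed
    fix a x assume a: "a \<in> J" and x: "x \<in> carrier (poly_ring n)"
    have "quasi_poly_part (q * (x * a))" if "q \<in> carrier (poly_ring n)" for q
      using a x that poly_ring_closed_mult[OF that x] by (simp add: J_def mult.assoc[symmetric])
    then show "x \<otimes>\<^bsub>poly_ring n\<^esub> a \<in> J" "a \<otimes>\<^bsub>poly_ring n\<^esub> x \<in> J"
      using a x poly_ring_closed_mult[of x n a] by (auto simp: J_def mult.commute[of a x])
  qed (rule ring_axioms)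
  have gen: "lin_form n \<xi> g ^ D \<in> J" for g
  proof -
    have "quasi_poly_part (q * lin_form n \<xi> g ^ D)" if q: "q \<in> carrier (poly_ring n)" for q
    proof -
      have "q * lin_form n \<xi> g ^ D =
          (\<Sum>e\<in>keys q. pconst (lookup q e) * (single e 1 * lin_form n \<xi> g ^ D))"
        by (subst poly_eq_sum_monomials[of q]) (simp only: sum_distrib_right mult.assoc)
      also have "quasi_poly_part \<dots>"
        using q by (intro quasi_poly_part_sum quasi_poly_part_scale quasi_poly_part_monomial_times_generator)
          (auto simp: poly_ring_carrier_iff)
      finally show ?thesis .
    qed
    then show ?thesis by (simp add: J_def lin_form_power_carrier)
  qed
  have "I \<subseteq> J" unfolding I_ideal_def D_def[symmetric] by (rule genideal_minimal[OF J]) (auto intro: gen)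
  then have "quasi_poly_part (1 * p)"
    using assms one_closed unfolding J_def poly_ring_simps by blast
  then show ?thesis by simp
qed

text \<open>
  The exponents of the standard monomials, whose classes turn out to be a basis of the component
  of degree \<open>D + j\<close> of the quotient.
\<close>

definition std_exps :: "(nat \<Rightarrow>\<^sub>0 nat) set" where
  "std_exps = {e \<in> exps n (D + j). j < quot_deg n k e}"

text \<open>
  If the coefficients of an element of the ideal vanish at all exponents of the degree in question
  with \<open>quot_deg\<close> at most \<open>j\<close>, then so does the quasi-polynomial giving them on a residue class, and
  interpolation makes it zero on that class.
\<close>

lemma std_independent:
  assumes p: "p \<in> I" "keys p \<subseteq> std_exps"
  shows "p = 0"
proof (rule ccontr)
  assume "p \<noteq> 0"
  then obtain e0 where e0: "e0 \<in> keys p" 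
    using keys_eq_empty[of p] by blast
  then have e0': "e0 \<in> exps n (D + j)" "j < quot_deg n k e0" using p(2) by (auto simp: std_exps_def)
  obtain f where f: "quasi_poly n \<xi> j f" "\<And>e. e \<in> exps n (D + j) \<Longrightarrow> efact n e * lookup p e = f e"
    using quasi_poly_part_I[OF p(1)] unfolding quasi_poly_part_def by auto
  let ?h = "\<lambda>e. of_bool (same_residues n k e e0) * f e"
  have h: "quasi_poly n \<xi> j ?h" using quasi_poly_mult[OF quasi_poly_same_residues[OF \<xi> k] f(1)] by simp
  have "?h e0 = 0"
  proof (rule differences_vanish_unique[OF k, where f = ?h and m = "Suc j"])
    show "differences_vanish n k (Suc j) ?h"
      using quasi_poly_differences_vanish[OF h] \<xi> by (simp add: primitive_root_of_unity_def)
    fix v assume v: "quot_deg n k v < Suc j"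
    show "?h v = 0"
    proof (cases "same_residues n k v e0")
      case True
      \<comment> \<open>The coordinates \<open>1, \<dots>, n\<close> of \<open>v\<close> have a sum at most \<open>D + j\<close>, since they have the residues of \<open>e0\<close>
        and smaller quotients. So \<open>v\<close> can be altered in the coordinate \<open>0\<close> to an exponent \<open>w\<close> of
        degree \<open>D + j\<close>, without changing the value of \<open>f\<close>.\<close>
      have split: "(\<Sum>l=1..n. lookup e l) = k * quot_deg n k e + (\<Sum>l=1..n. lookup e l mod k)" for e
        unfolding quot_deg_def sum_distrib_left sum.distrib[symmetric] by simp
      have s: "{..n} = insert 0 {1..n}" by auto
      have "(\<Sum>l=1..n. lookup v l mod k) = (\<Sum>l=1..n. lookup e0 l mod k)"
        using True by (auto simp: same_residues_def)
      moreover have "k * quot_deg n k v \<le> k * quot_deg n k e0" using v e0'(2) by (intro mult_left_mono) auto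
      ultimately have "(\<Sum>l=1..n. lookup v l) \<le> (\<Sum>l=1..n. lookup e0 l)"
        unfolding split[of v] split[of e0] by linarith
      also have "\<dots> \<le> D + j" using exps_degree[OF e0'(1)] by (simp add: s)
      finally have le: "(\<Sum>l=1..n. lookup v l) \<le> D + j" .
      define w where "w = single 0 (D + j - (\<Sum>l=1..n. lookup v l)) + coord_vec n (lookup v)"
      have w: "lookup w l = (if l = 0 then D + j - (\<Sum>l=1..n. lookup v l) else if l \<le> n then lookup v l else 0)" for l
        by (auto simp: w_def lookup_add lookup_coord_vec lookup_single)
      have "keys w \<subseteq> {0..n}" using w by (auto simp: in_keys_iff split: if_splits)
      moreover from this have "mon_degree w = (\<Sum>l\<le>n. lookup w l)"
        by (subst mon_degree_eq_sum[of "{..n}"]) auto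
      then have "mon_degree w = D + j" using le by (simp add: s w)
      ultimately have wE: "w \<in> exps n (D + j)" by (simp add: exps_def)
      have "quot_deg n k w = quot_deg n k v" by (simp add: quot_deg_def w)
      then have "w \<notin> keys p" using v p(2) by (auto simp: std_exps_def)
      then have "f w = 0" using f(2)[OF wE] by (simp add: in_keys_iff)
      moreover have "f v = f w" by (rule quasi_poly_cong_coords[OF f(1)]) (simp add: w)
      ultimately show ?thesis by simp
    qed simp
  qed
  then have "f e0 = 0" by (simp add: same_residues_def)
  then have "lookup p e0 = 0" using f(2)[OF e0'(1)] by auto
  then show False using e0 by (simp add: in_keys_iff)
qed

text \<open>
  The form of the Newton basis element of \<open>e0\<close> lies in the ideal and expresses the monomial of \<open>e0\<close>
  by monomials with larger \<open>quot_deg\<close>.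
\<close>

lemma std_span_monomial:
  assumes "e0 \<in> exps n (D + j)"
  shows "\<exists>q. keys q \<subseteq> std_exps \<and> single e0 1 - q \<in> I"
  using assms
proof (induction "Suc j - quot_deg n k e0" arbitrary: e0 rule: less_induct)
  case less
  show ?case
  proof (cases "j < quot_deg n k e0")
    case True
    then show ?thesis using less.prems I_zero
      by (intro exI[of _ "single e0 1"]) (auto simp: std_exps_def)
  next
    case False
    let ?E = "exps n (D + j) - {e0}" and ?f = "newton n k e0"
    let ?a = "\<lambda>e. ?f e / efact n e"
    have "\<exists>q. keys q \<subseteq> std_exps \<and> pconst (?a e) * single e 1 - q \<in> I" if e: "e \<in> ?E" for e
    proof (cases "?f e = 0")
      case True
      then show ?thesis using I_zero by (intro exI[of _ 0]) (simp add: pconst_def)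
    next
      case False
      then have "quot_deg n k e0 < quot_deg n k e" using newton_nonzeroD e less.prems by blast
      then obtain q where q: "keys q \<subseteq> std_exps" "single e 1 - q \<in> I"
        using less.hyps[of e] e \<open>\<not> j < quot_deg n k e0\<close>
        by (meson Diff_iff diff_less_mono2 less_Suc_eq_le not_less order_less_le_trans less_SucI)
      have "keys (pconst (?a e) * q) \<subseteq> std_exps"
        using q(1) by (auto simp: in_keys_iff[of _ "_ * _"] lookup_pconst_mult in_keys_iff)
      then show ?thesis using I_scale[OF q(2), of "?a e"]
        by (intro exI[of _ "pconst (?a e) * q"]) (simp add: right_diff_distrib)
    qed
    then obtain q where q: "\<And>e. e \<in> ?E \<Longrightarrow> keys (q e) \<subseteq> std_exps"
        "\<And>e. e \<in> ?E \<Longrightarrow> pconst (?a e) * single e 1 - q e \<in> I"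
      by metis
    have a0: "?a e0 \<noteq> 0" by (simp add: newton_self)
    have "dp_form n (D + j) ?f \<in> I"
      using False by (intro dp_form_quasi_poly quasi_poly_mono[OF quasi_poly_newton[OF \<xi> k]]) auto
    also have "dp_form n (D + j) ?f = pconst (?a e0) * single e0 1 + (\<Sum>e\<in>?E. pconst (?a e) * single e 1)"
      unfolding dp_form_def by (subst sum.remove[OF finite_exps less.prems])
        (simp add: pconst_def mult_single)
    finally have "pconst (?a e0) * single e0 1 + (\<Sum>e\<in>?E. pconst (?a e) * single e 1) \<in> I" .
    moreover have "(\<Sum>e\<in>?E. pconst (?a e) * single e 1 - q e) \<in> I" by (intro I_sum q(2))
    ultimately have "pconst (?a e0) * single e0 1 + (\<Sum>e\<in>?E. q e) \<in> I"
      using I_add[OF _ I_uminus] by (fastforce simp: sum_subtractf)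
    then have "pconst (1 / ?a e0) * (pconst (?a e0) * single e0 1 + (\<Sum>e\<in>?E. q e)) \<in> I"
      by (rule I_scale)
    also have "pconst (1 / ?a e0) * (pconst (?a e0) * single e0 1 + (\<Sum>e\<in>?E. q e)) =
        single e0 1 - pconst (- (1 / ?a e0)) * (\<Sum>e\<in>?E. q e)"
      by (rule poly_mapping_eqI, unfold lookup_pconst_mult lookup_add lookup_minus)
        (use a0 in \<open>simp add: field_simps\<close>)
    finally have "single e0 1 - pconst (- (1 / ?a e0)) * (\<Sum>e\<in>?E. q e) \<in> I" .
    moreover have "keys (pconst (- (1 / ?a e0)) * (\<Sum>e\<in>?E. q e)) \<subseteq> std_exps"
    proof -
      have "keys (pconst (- (1 / ?a e0)) * (\<Sum>e\<in>?E. q e)) \<subseteq> keys (\<Sum>e\<in>?E. q e)"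
        by (auto simp: in_keys_iff lookup_pconst_mult)
      then show ?thesis using keys_sum[of q ?E] q(1) by blast
    qed
    ultimately show ?thesis by blast
  qed
qed

lemma std_span:
  assumes "p \<in> homogeneous_part n (D + j)"
  shows "\<exists>q. keys q \<subseteq> std_exps \<and> p - q \<in> I"
proof -
  obtain q where q: "\<And>e. e \<in> keys p \<Longrightarrow> keys (q e) \<subseteq> std_exps"
      "\<And>e. e \<in> keys p \<Longrightarrow> single e 1 - q e \<in> I"
    using std_span_monomial assms unfolding homogeneous_part_iff by (metis subsetD)
  let ?q = "\<Sum>e\<in>keys p. pconst (lookup p e) * q e"
  have "p - ?q = (\<Sum>e\<in>keys p. pconst (lookup p e) * (single e 1 - q e))"
    by (subst poly_eq_sum_monomials[of p]) (simp only: sum_subtractf right_diff_distrib)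
  also have "\<dots> \<in> I" by (intro I_sum I_scale q(2))
  finally have "p - ?q \<in> I" .
  moreover have "keys (pconst (lookup p e) * q e) \<subseteq> keys (q e)" for e
    by (auto simp: in_keys_iff lookup_pconst_mult)
  then have "keys ?q \<subseteq> std_exps"
    using keys_sum[of "\<lambda>e. pconst (lookup p e) * q e" "keys p"] q(1) by blast
  ultimately show ?thesis by blast
qed

section \<open>The dimension as a number of monomials\<close>

abbreviation "R \<equiv> R_ring n k d \<xi>"
abbreviation "cls \<equiv> R_class n k d \<xi>"

lemma ring_R: "ring R"
  unfolding R_ring_def by (rule ideal.quotient_is_ring[OF ideal_I])

lemma R_class_hom: "cls \<in> ring_hom (poly_ring n) R"
proof -
  have "cls = (+>\<^bsub>poly_ring n\<^esub>) I" by (simp add: R_class_def fun_eq_iff)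
  then show ?thesis unfolding R_ring_def using ideal.rcos_ring_hom[OF ideal_I] by simp
qed

lemma R_class_add:
  "p \<in> carrier (poly_ring n) \<Longrightarrow> q \<in> carrier (poly_ring n) \<Longrightarrow> cls p \<oplus>\<^bsub>R\<^esub> cls q = cls (p + q)"
  using ring_hom_add[OF R_class_hom] by simp

lemma R_class_mult:
  "p \<in> carrier (poly_ring n) \<Longrightarrow> q \<in> carrier (poly_ring n) \<Longrightarrow> cls p \<otimes>\<^bsub>R\<^esub> cls q = cls (p * q)"
  using ring_hom_mult[OF R_class_hom] by simp

lemma R_class_eq_iff:
  assumes "p \<in> carrier (poly_ring n)" "q \<in> carrier (poly_ring n)"
  shows "cls p = cls q \<longleftrightarrow> p - q \<in> I"
proof -
  interpret cring "poly_ring n" by (rule cring_poly_ring)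
  show ?thesis
    using quotient_eq_iff_same_a_r_cos[OF ideal_I assms] poly_ring_minus[OF assms]
    by (simp add: R_class_def)
qed

lemma R_class_zero: "cls 0 = \<zero>\<^bsub>R\<^esub>"
  using ring_hom_zero[OF R_class_hom _ ring_R] cring.axioms(1)[OF cring_poly_ring] by simp

lemma finite_std_exps: "finite std_exps"
  using finite_exps by (auto simp: std_exps_def)

lemma keys_std_carrier: "keys p \<subseteq> std_exps \<Longrightarrow> p \<in> carrier (poly_ring n)"
  by (auto simp: poly_ring_carrier_iff std_exps_def exps_def subset_iff)

text \<open>Each further standard monomial is independent of the previous ones and extends their span.\<close>

lemma dimension_std_span:
  assumes "finite T" "T \<subseteq> std_exps"
  shows "ring.dimension R (card T) (R_scalars n k d \<xi>) (cls ` {p. keys p \<subseteq> T})"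
  using assms
proof (induction T)
  case empty
  have "cls ` {p. keys p \<subseteq> {}} = {\<zero>\<^bsub>R\<^esub>}" by (auto simp: R_class_zero[symmetric])
  then show ?case using ring.zero_dim[OF ring_R] by simp
next
  case (insert e T)
  let ?v = "cls (single e 1)" and ?E = "cls ` {p. keys p \<subseteq> T}"
  have carr: "p \<in> carrier (poly_ring n)" if "keys p \<subseteq> insert e T" for p
    using that insert.prems by (intro keys_std_carrier) auto
  have se: "single e c \<in> carrier (poly_ring n)" for c by (rule carr) simp
  have "?v \<in> carrier R" using ring_hom_closed[OF R_class_hom se] .
  moreover have "?v \<notin> ?E"
  proof
    assume "?v \<in> ?E"
    then obtain p where p: "keys p \<subseteq> T" "?v = cls p" by auto
    have "single e 1 - p \<in> I" using p se carr[of p] by (subst R_class_eq_iff[symmetric]) auto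
    moreover have "keys (single e 1 - p) \<subseteq> std_exps"
      using keys_diff[of "single e 1" p] p(1) insert.prems by auto
    ultimately have "single e 1 - p = 0" by (rule std_independent)
    then have "p = single e 1" by simp
    then have "e \<in> keys p" by simp
    then show False using p(1) insert.hyps(2) by auto
  qed
  moreover have "ring.dimension R (card T) (R_scalars n k d \<xi>) ?E" using insert by simp
  ultimately have "ring.dimension R (Suc (card T)) (R_scalars n k d \<xi>)
      (ring.line_extension R (R_scalars n k d \<xi>) ?v ?E)"
    by (rule ring.Suc_dim[OF ring_R])
  moreover have "ring.line_extension R (R_scalars n k d \<xi>) ?v ?E = cls ` {p. keys p \<subseteq> insert e T}"
  proof -
    have comb: "cls (pconst c) \<otimes>\<^bsub>R\<^esub> ?v \<oplus>\<^bsub>R\<^esub> cls p = cls (single e c + p)" if "keys p \<subseteq> T" for c p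
    proof -
      have "pconst c * single e 1 = single e c" by (simp add: pconst_def mult_single)
      then show ?thesis using se pconst_carrier carr[of p] that
        by (simp add: R_class_mult R_class_add subset_insertI2)
    qed
    show ?thesis
    proof (intro equalityI subsetI)
      fix u assume "u \<in> ring.line_extension R (R_scalars n k d \<xi>) ?v ?E"
      then obtain c p where "keys p \<subseteq> T" "u = cls (single e c + p)"
        unfolding ring.line_extension_mem_iff[OF ring_R] R_scalars_def by (auto simp: comb)
      moreover have "keys (single e c + p) \<subseteq> insert e T"
        using keys_add[of "single e c" p] \<open>keys p \<subseteq> T\<close> by (auto split: if_splits)
      ultimately show "u \<in> cls ` {p. keys p \<subseteq> insert e T}" by blast
    next
      fix u assume "u \<in> cls ` {p. keys p \<subseteq> insert e T}"
      then obtain p where p: "keys p \<subseteq> insert e T" "u = cls p" by auto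
      let ?q = "p - single e (lookup p e)"
      have q: "keys ?q \<subseteq> T" using p(1) by (auto simp: in_keys_iff lookup_minus lookup_single when_def split: if_splits)
      have "u = cls (pconst (lookup p e)) \<otimes>\<^bsub>R\<^esub> ?v \<oplus>\<^bsub>R\<^esub> cls ?q"
        using comb[OF q] p(2) by simp
      then show "u \<in> ring.line_extension R (R_scalars n k d \<xi>) ?v ?E"
        unfolding ring.line_extension_mem_iff[OF ring_R] R_scalars_def using q by blast
    qed
  qed
  ultimately show ?case using insert.hyps by simp
qed

lemma dimension_R_component:
  "ring.dimension R (card std_exps) (R_scalars n k d \<xi>) (R_component n k d \<xi> (D + j))"
proof -
  have "R_component n k d \<xi> (D + j) = cls ` {p. keys p \<subseteq> std_exps}"
  proof (intro equalityI subsetI)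
    fix u assume "u \<in> R_component n k d \<xi> (D + j)"
    then obtain p where p: "p \<in> homogeneous_part n (D + j)" "u = cls p"
      by (auto simp: R_component_def)
    obtain q where q: "keys q \<subseteq> std_exps" "p - q \<in> I" using std_span[OF p(1)] by auto
    have "cls p = cls q"
      using p(1) q by (subst R_class_eq_iff) (auto simp: homogeneous_part_def keys_std_carrier)
    then show "u \<in> cls ` {p. keys p \<subseteq> std_exps}" using p q by auto
  next
    fix u assume "u \<in> cls ` {p. keys p \<subseteq> std_exps}"
    then obtain p where p: "keys p \<subseteq> std_exps" "u = cls p" by blast
    have "std_exps \<subseteq> exps n (D + j)" by (auto simp: std_exps_def)
    with p(1) have "p \<in> homogeneous_part n (D + j)" unfolding homogeneous_part_iff by (rule subset_trans)
    then show "u \<in> R_component n k d \<xi> (D + j)"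
      unfolding R_component_def using p(2) by (rule rev_image_eqI)
  qed
  then show ?thesis using dimension_std_span[OF finite_std_exps] by simp
qed
end

section \<open>A binomial identity\<close>

lemma alternating_binomial_sum_Suc:
  fixes f :: "nat \<Rightarrow> real"
  shows "(\<Sum>s\<le>Suc m. (-1) ^ s * real (Suc m choose s) * f s) =
    (\<Sum>s\<le>m. (-1) ^ s * real (m choose s) * (f s - f (Suc s)))"
proof -
  have "(\<Sum>s\<le>Suc m. (-1) ^ s * real (Suc m choose s) * f s) =
      f 0 + (\<Sum>s\<le>m. (-1) ^ Suc s * real (m choose Suc s) * f (Suc s))
        + (\<Sum>s\<le>m. (-1) ^ Suc s * real (m choose s) * f (Suc s))"
    unfolding sum.atMost_Suc_shift
    by (simp add: algebra_simps sum.distrib sum_subtractf sum_negf)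
  also have "f 0 + (\<Sum>s\<le>m. (-1) ^ Suc s * real (m choose Suc s) * f (Suc s)) =
      (\<Sum>s\<le>Suc m. (-1) ^ s * real (m choose s) * f s)"
    unfolding sum.atMost_Suc_shift by simp
  also have "\<dots> = (\<Sum>s\<le>m. (-1) ^ s * real (m choose s) * f s)" by simp
  finally show ?thesis by (simp add: algebra_simps sum.distrib sum_subtractf sum_negf)
qed

lemma alternating_binomial_sum_reciprocal:
  assumes "a > (0 :: real)"
  shows "(\<Sum>s\<le>m. (-1) ^ s * real (m choose s) * (1 / (real s + a))) = fact m / (\<Prod>r\<le>m. a + real r)"
  using assms
proof (induction m arbitrary: a)
  case (Suc m)
  have "(\<Sum>s\<le>Suc m. (-1) ^ s * real (Suc m choose s) * (1 / (real s + a))) =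
      (\<Sum>s\<le>m. (-1) ^ s * real (m choose s) * (1 / (real s + a))) -
      (\<Sum>s\<le>m. (-1) ^ s * real (m choose s) * (1 / (real s + (a + 1))))"
    unfolding alternating_binomial_sum_Suc
    by (simp add: right_diff_distrib sum_subtractf add.assoc add.commute[of 1])
  also have "\<dots> = fact m / (\<Prod>r\<le>m. a + real r) - fact m / (\<Prod>r\<le>m. (a + 1) + real r)"
    using Suc.prems by (simp only: Suc.IH[of a] Suc.IH[of "a + 1"] add_pos_pos zero_less_one)
  also have "\<dots> = fact (Suc m) / (\<Prod>r\<le>Suc m. a + real r)"
  proof -
    let ?P = "\<Prod>r<m. a + 1 + real r"
    have P: "?P \<noteq> 0" "a \<noteq> 0" "a + 1 + real m \<noteq> 0"
      using Suc.prems by (auto intro!: prod_pos add_pos_nonneg simp: less_imp_neq[symmetric] prod_zero_iff)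
    have 1: "(\<Prod>r\<le>m. a + real r) = a * ?P"
      by (cases m) (simp_all only: lessThan_Suc_atMost[symmetric] prod.lessThan_Suc_shift, simp_all add: algebra_simps)
    have 2: "(\<Prod>r\<le>m. (a + 1) + real r) = ?P * (a + 1 + real m)"
      by (simp only: lessThan_Suc_atMost[symmetric] prod.lessThan_Suc)
    have 3: "(\<Prod>r\<le>Suc m. a + real r) = a * ?P * (a + 1 + real m)"
      by (simp add: 1 algebra_simps)
    show ?thesis unfolding 1 2 3 using P by (simp add: divide_simps) (simp add: algebra_simps)
  qed
  finally show ?case .
qed simp

lemma alternating_binomial_sum_prod_eq_0:
  fixes x :: "nat \<Rightarrow> real"
  assumes "q < m"
  shows "(\<Sum>s\<le>m. (-1) ^ s * real (m choose s) * (\<Prod>r<q. x r - real s)) = 0"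
  using assms
proof (induction q arbitrary: m x)
  case 0
  then show ?case using choose_alternating_sum[of m, where 'a = real] by simp
next
  case (Suc q)
  then obtain m' where m: "m = Suc m'" by (cases m) auto
  let ?g = "\<lambda>s. \<Prod>r<q. x r - real s"
  have absorb: "real (Suc m' choose Suc s) * real (Suc s) = real (Suc m') * real (m' choose s)" for s
    using Suc_times_binomial_eq[of m' s] by (metis of_nat_mult mult.commute)
  have "(\<Sum>s\<le>m. (-1) ^ s * real (m choose s) * (\<Prod>r<Suc q. x r - real s)) =
      x q * (\<Sum>s\<le>m. (-1) ^ s * real (m choose s) * ?g s) -
      (\<Sum>s\<le>m. (-1) ^ s * (real (m choose s) * real s) * ?g s)"
    by (simp add: algebra_simps sum_subtractf sum_distrib_left)
  also have "(\<Sum>s\<le>m. (-1) ^ s * real (m choose s) * ?g s) = 0" using Suc by simp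
  also have "(\<Sum>s\<le>m. (-1) ^ s * (real (m choose s) * real s) * ?g s) =
      (\<Sum>s\<le>m'. (-1) ^ Suc s * (real (Suc m') * real (m' choose s)) * (\<Prod>r<q. (x r - 1) - real s))"
    unfolding m sum.atMost_Suc_shift by (simp only: absorb) (simp add: algebra_simps)
  also have "\<dots> = - real (Suc m') *
      (\<Sum>s\<le>m'. (-1) ^ s * real (m' choose s) * (\<Prod>r<q. (x r - 1) - real s))"
    unfolding sum_distrib_left by (intro sum.cong refl) (simp only: power_Suc mult_minus1 mult_minus_left mult_ac)
  also have "\<dots> = 0" using Suc m by simp
  finally show ?case by simp
qed

text \<open>
  Lagrange interpolation at the point $-a$ of a polynomial of degree $q \le m$, given by its roots
  $x_r$, from its values at $0, \ldots, m$.
\<close>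

lemma alternating_binomial_sum_interpolation:
  fixes x :: "nat \<Rightarrow> real"
  assumes "q \<le> m" "a > 0"
  shows "(\<Sum>s\<le>m. (-1) ^ s * real (m choose s) * ((\<Prod>r<q. x r - real s) / (real s + a))) =
    (\<Prod>r<q. x r + a) * (fact m / (\<Prod>r\<le>m. a + real r))"
  using assms(1)
proof (induction q)
  case 0
  then show ?case using alternating_binomial_sum_reciprocal[OF assms(2), of m] by simp
next
  case (Suc q)
  let ?g = "\<lambda>s. \<Prod>r<q. x r - real s"
  have "(\<Prod>r<Suc q. x r - real s) / (real s + a) = (x q + a) * (?g s / (real s + a)) - ?g s" for s
    using assms(2) by (simp add: field_simps)
  then have "(\<Sum>s\<le>m. (-1) ^ s * real (m choose s) * ((\<Prod>r<Suc q. x r - real s) / (real s + a))) =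
      (\<Sum>s\<le>m. (-1) ^ s * real (m choose s) * ((x q + a) * (?g s / (real s + a)) - ?g s))"
    by (simp only:)
  also have "\<dots> = (x q + a) * (\<Sum>s\<le>m. (-1) ^ s * real (m choose s) * (?g s / (real s + a))) -
      (\<Sum>s\<le>m. (-1) ^ s * real (m choose s) * ?g s)"
    unfolding sum_distrib_left sum_subtractf[symmetric] by (intro sum.cong) (auto simp: right_diff_distrib)
  also have "\<dots> = (x q + a) * ((\<Prod>r<q. x r + a) * (fact m / (\<Prod>r\<le>m. a + real r)))"
    using Suc alternating_binomial_sum_prod_eq_0[of q m x] by simp
  finally show ?case by (simp add: mult.commute mult.left_commute)
qed

lemma binomial_eq_prod: "real (a choose m) = (\<Prod>r<m. real a - real r) / fact m"
  by (simp add: binomial_gbinomial gbinomial_prod_rev atLeast0LessThan)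

text \<open>
  The product of the first two binomial coefficients is a constant times
  $\binom{m}{s} / (s + j + 1)$, so this is interpolation at $-(j+1)$ of the third factor, a polynomial
  of degree $m$ in $s$.
\<close>

lemma binomial_identity:
  "(\<Sum>s\<le>m. (-1) ^ s * real ((j + s) choose s) * real ((j + Suc m) choose (m - s)) *
      real ((m + v - s) choose m)) = real ((m + v + Suc j) choose m)"
proof -
  let ?x = "\<lambda>r. real (m + v) - real r" and ?a = "real (Suc j)"
  let ?C = "fact (j + Suc m) / (fact j * fact m) :: real"
  have coef: "real ((j + s) choose s) * real ((j + Suc m) choose (m - s)) =
      ?C * real (m choose s) / (real s + ?a)" if "s \<le> m" for s
  proof -
    have e: "j + Suc m - (m - s) = Suc (j + s)" using that by simp
    have "real ((j + s) choose s) = fact (j + s) / (fact s * fact j)"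
      by (simp add: binomial_fact)
    moreover have "real ((j + Suc m) choose (m - s)) = fact (j + Suc m) / (fact (m - s) * fact (Suc (j + s)))"
      using that by (subst binomial_fact) (auto simp: e)
    moreover have "real (m choose s) = fact m / (fact s * fact (m - s))"
      using that by (simp add: binomial_fact)
    moreover have "(fact (Suc (j + s)) :: real) = (real s + ?a) * fact (j + s)"
      by (simp add: algebra_simps)
    moreover have "real s + ?a \<noteq> 0" by simp
    ultimately show ?thesis by (simp del: fact_Suc of_nat_Suc)
  qed
  have "(\<Sum>s\<le>m. (-1) ^ s * real ((j + s) choose s) * real ((j + Suc m) choose (m - s)) *
      real ((m + v - s) choose m)) =
    (\<Sum>s\<le>m. ?C / fact m * ((-1) ^ s * real (m choose s) * ((\<Prod>r<m. ?x r - real s) / (real s + ?a))))"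
  proof (intro sum.cong refl)
    fix s assume "s \<in> {..m}"
    then have s: "s \<le> m" by simp
    have "real ((m + v - s) choose m) = (\<Prod>r<m. ?x r - real s) / fact m"
      unfolding binomial_eq_prod using s by (simp add: of_nat_diff algebra_simps)
    then show "(-1) ^ s * real ((j + s) choose s) * real ((j + Suc m) choose (m - s)) *
        real ((m + v - s) choose m) =
        ?C / fact m * ((-1) ^ s * real (m choose s) * ((\<Prod>r<m. ?x r - real s) / (real s + ?a)))"
      unfolding mult.assoc[of "(-1) ^ s" "real _" "real _"] coef[OF s]
      by (simp only: times_divide_eq_left times_divide_eq_right divide_divide_eq_left mult_ac)
  qed
  also have "\<dots> = ?C / fact m * ((\<Prod>r<m. ?x r + ?a) * (fact m / (\<Prod>r\<le>m. ?a + real r)))"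
    unfolding sum_distrib_left[symmetric]
    by (subst alternating_binomial_sum_interpolation) auto
  also have "(\<Prod>r\<le>m. ?a + real r) = fact (j + Suc m) / fact j"
  proof -
    have "fact j * (\<Prod>r\<le>m'. ?a + real r) = fact (j + Suc m')" for m'
    proof (induction m')
      case (Suc m')
      have "fact j * (\<Prod>r\<le>Suc m'. ?a + real r) = fact (j + Suc m') * (?a + real (Suc m'))"
        by (simp only: prod.atMost_Suc mult.assoc[symmetric] Suc.IH)
      also have "\<dots> = fact (j + Suc (Suc m'))"
        unfolding add_Suc_right[of j "Suc m'"] fact_Suc[of "j + Suc m'"] by simp
      finally show ?case .
    qed (simp add: algebra_simps)
    then show ?thesis by (simp add: eq_divide_eq mult.commute del: fact_Suc)
  qed
  also have "(\<Prod>r<m. ?x r + ?a) = fact m * real ((m + v + Suc j) choose m)"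
    unfolding binomial_eq_prod by (simp add: algebra_simps)
  finally show ?thesis by simp
qed

section \<open>Counting the standard monomials\<close>

lemma card_exponents_insert:
  assumes A: "finite A" and a: "a \<notin> A"
  shows "card {e. keys e \<subseteq> insert a A \<and> mon_degree e = q} =
    (\<Sum>r\<le>q. card {e. keys e \<subseteq> A \<and> mon_degree e = q - r})"
proof -
  let ?E = "\<lambda>A q. {e :: nat \<Rightarrow>\<^sub>0 nat. keys e \<subseteq> A \<and> mon_degree e = q}"
  have fin: "finite (?E A q)" for q
    by (rule finite_subset[OF _ finite_bounded_exponents[OF A, of q]]) auto
  have z: "lookup e a = 0" if "keys e \<subseteq> A" for e :: "nat \<Rightarrow>\<^sub>0 nat"
    using that a by (auto simp: in_keys_iff)
  have "bij_betw (\<lambda>(r, e). single a r + e) (SIGMA r:{..q}. ?E A (q - r)) (?E (insert a A) q)"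
  proof (rule bij_betw_byWitness[where f' = "\<lambda>e. (lookup e a, e - single a (lookup e a))"])
    show "\<forall>p\<in>SIGMA r:{..q}. ?E A (q - r).
        (\<lambda>e. (lookup e a, e - single a (lookup e a))) ((\<lambda>(r, e). single a r + e) p) = p"
      using z by (auto simp: lookup_add)
    have split: "single a (lookup e a) + (e - single a (lookup e a)) = e" for e :: "nat \<Rightarrow>\<^sub>0 nat"
      by (rule exponent_split[symmetric]) (simp add: lookup_single when_def)
    then show "\<forall>e\<in>?E (insert a A) q. (\<lambda>(r, e). single a r + e)
        ((\<lambda>e. (lookup e a, e - single a (lookup e a))) e) = e" by simp
    show "(\<lambda>(r, e). single a r + e) ` (SIGMA r:{..q}. ?E A (q - r)) \<subseteq> ?E (insert a A) q"
      by (auto simp: keys_add_nat mon_degree_add mon_degree_single split: if_splits)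
    show "(\<lambda>e. (lookup e a, e - single a (lookup e a))) ` ?E (insert a A) q
        \<subseteq> (SIGMA r:{..q}. ?E A (q - r))"
    proof (rule image_subsetI)
      fix e assume "e \<in> ?E (insert a A) q"
      then have e: "keys e \<subseteq> insert a A" "mon_degree e = q" by simp_all
      let ?e = "e - single a (lookup e a)"
      have "mon_degree e = lookup e a + mon_degree ?e"
        by (subst split[of e, symmetric]) (simp only: mon_degree_add mon_degree_single)
      moreover have "keys ?e \<subseteq> A"
      proof
        fix x assume "x \<in> keys ?e"
        then have "x \<in> keys e" "x \<noteq> a"
          by (auto simp: in_keys_iff lookup_minus lookup_single when_def split: if_splits)
        then show "x \<in> A" using e(1) by blast
      qed
      ultimately show "(lookup e a, ?e) \<in> (SIGMA r:{..q}. ?E A (q - r))" using e(2) by simp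
    qed
  qed
  then have "card (?E (insert a A) q) = card (SIGMA r:{..q}. ?E A (q - r))"
    by (simp add: bij_betw_same_card)
  also have "\<dots> = (\<Sum>r\<le>q. card (?E A (q - r)))"
    by (rule card_SigmaI) (auto simp: fin)
  finally show ?thesis .
qed

lemma card_exponents:
  assumes "finite A" "card A = Suc m"
  shows "card {e. keys e \<subseteq> A \<and> mon_degree e = q} = (m + q) choose m"
  using assms
proof (induction m arbitrary: A q)
  case 0
  then obtain a where "A = {a}" by (metis card_1_singletonE One_nat_def)
  moreover have "{e :: nat \<Rightarrow>\<^sub>0 nat. keys e \<subseteq> {} \<and> mon_degree e = q'} = (if q' = 0 then {0} else {})" for q'
    by (auto simp: mon_degree_def)
  then have "card {e. keys e \<subseteq> {} \<and> mon_degree e = q - r} = (if r = q then 1 else 0)" if "r \<le> q" for r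
    using that by (simp only:) auto
  ultimately show ?case using card_exponents_insert[of "{}" a q]
    by (simp only: finite.emptyI empty_iff not_False_eq_True atMost_iff cong: sum.cong) simp
next
  case (Suc m)
  then obtain a B where A: "A = insert a B" "a \<notin> B" "card B = Suc m" "finite B"
    by (metis card_Suc_eq finite_insert)
  have "card {e. keys e \<subseteq> A \<and> mon_degree e = q} = (\<Sum>r\<le>q. (m + (q - r)) choose m)"
    unfolding A(1) card_exponents_insert[OF A(4) A(2)] using Suc.IH A by simp
  also have "\<dots> = (\<Sum>r\<le>q. (m + r) choose m)"
    by (rule sum.reindex_bij_witness[of _ "\<lambda>r. q - r" "\<lambda>r. q - r"]) auto
  also have "\<dots> = (\<Sum>r\<le>q. (m + r) choose r)"
    by (intro sum.cong refl) (simp add: binomial_symmetric[of m "m + _"])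
  also have "\<dots> = Suc (m + q) choose q" by (rule sum_choose_lower)
  also have "\<dots> = (Suc m + q) choose Suc m" by (simp add: binomial_symmetric[of q])
  finally show ?case .
qed

lemma card_exps: "card (exps n q) = (n + q) choose n"
  unfolding exps_def by (rule card_exponents) auto

text \<open>
  Exponents of degree \<open>q\<close> that are reduced modulo \<open>k\<close> in the coordinates \<open>1, \<dots>, n\<close>; the
  coordinate \<open>0\<close> is not bounded.
\<close>

definition reduced_exps :: "nat \<Rightarrow> nat \<Rightarrow> nat \<Rightarrow> (nat \<Rightarrow>\<^sub>0 nat) set" where
  "reduced_exps n k q = {w \<in> exps n q. \<forall>l\<in>{1..n}. lookup w l < k}"

lemma exps_decomposition:
  "coord_vec n (\<lambda>l. k * (lookup e l div k)) + (e - coord_vec n (\<lambda>l. k * (lookup e l div k))) = e"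
  by (rule exponent_split[symmetric]) (simp add: lookup_coord_vec)

lemma exps_quot_deg_le:
  assumes "e \<in> exps n q"
  shows "k * quot_deg n k e \<le> q"
proof -
  have "k * quot_deg n k e = mon_degree (coord_vec n (\<lambda>l. k * (lookup e l div k)))"
    by (simp add: mon_degree_coord_vec quot_deg_def sum_distrib_left)
  then show ?thesis
    using assms exps_decomposition[of n k e] by (metis add_in_exps_iff)
qed

text \<open>
  Division with remainder in the coordinates \<open>1, \<dots>, n\<close> splits an exponent uniquely into a reduced
  exponent and the vector of its quotients.
\<close>

lemma card_exps_quot_deg:
  assumes n: "n \<ge> 1" and k: "k > 0"
  shows "card {e \<in> exps n q. quot_deg n k e = t} =
    (if k * t \<le> q then card (reduced_exps n k (q - k * t)) * ((n - 1 + t) choose (n - 1)) else 0)"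
proof (cases "k * t \<le> q")
  case False
  then have "{e \<in> exps n q. quot_deg n k e = t} = {}" using exps_quot_deg_le by blast
  then show ?thesis using False by (simp only: card.empty if_False)
next
  case True
  let ?C = "{c. keys c \<subseteq> {1..n} \<and> mon_degree c = t}" and ?W = "reduced_exps n k (q - k * t)"
  let ?f = "\<lambda>(w, c). coord_vec n (\<lambda>l. k * lookup c l) + w"
  let ?v = "\<lambda>e. coord_vec n (\<lambda>l. k * (lookup e l div k))"
  let ?g = "\<lambda>e. (e - ?v e, coord_vec n (\<lambda>l. lookup e l div k))"
  have "bij_betw ?f (?W \<times> ?C) {e \<in> exps n q. quot_deg n k e = t}"
  proof (rule bij_betw_byWitness[where f' = ?g])
    have C: "coord_vec n (lookup c) = c" if "c \<in> ?C" for c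
      using that by (intro poly_mapping_eqI) (auto simp: lookup_coord_vec in_keys_iff)
    have div: "(k * x + y) div k = x" if "y < k" for x y
      using that k by simp
    show "\<forall>p\<in>?W \<times> ?C. ?g (?f p) = p"
    proof
      fix p assume "p \<in> ?W \<times> ?C"
      moreover obtain w c where p: "p = (w, c)" by (cases p)
      ultimately have w: "w \<in> ?W" and c: "keys c \<subseteq> {1..n}" "mon_degree c = t" by simp_all
      let ?e = "coord_vec n (\<lambda>l. k * lookup c l) + w"
      have d: "lookup ?e l div k = lookup c l" if "l \<in> {1..n}" for l
        using that w by (auto simp: lookup_add lookup_coord_vec reduced_exps_def div)
      have "?v ?e = coord_vec n (\<lambda>l. k * lookup c l)"
        by (rule coord_vec_cong) (simp only: d)
      moreover have "coord_vec n (\<lambda>l. lookup ?e l div k) = coord_vec n (lookup c)"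
        by (rule coord_vec_cong) (simp only: d)
      ultimately show "?g (?f p) = p"
        using C[of c] c by (simp only: p prod.case) simp
    qed
    show "\<forall>e\<in>{e \<in> exps n q. quot_deg n k e = t}. ?f (?g e) = e"
    proof
      fix e
      have "coord_vec n (\<lambda>l. k * lookup (coord_vec n (\<lambda>l. lookup e l div k)) l) = ?v e"
        by (rule poly_mapping_eqI) (simp add: lookup_coord_vec)
      then show "?f (?g e) = e" by (simp only: prod.case exps_decomposition)
    qed
    show "?f ` (?W \<times> ?C) \<subseteq> {e \<in> exps n q. quot_deg n k e = t}"
    proof (rule image_subsetI)
      fix p assume "p \<in> ?W \<times> ?C"
      moreover obtain w c where p: "p = (w, c)" by (cases p)
      ultimately have w: "w \<in> ?W" and c: "keys c \<subseteq> {1..n}" "mon_degree c = t" by simp_all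
      let ?e = "coord_vec n (\<lambda>l. k * lookup c l) + w"
      have s: "(\<Sum>l=1..n. lookup c l) = t" using c mon_degree_eq_sum[of "{1..n}" c] by simp
      have "quot_deg n k ?e = (\<Sum>l=1..n. lookup c l)"
        unfolding quot_deg_def using w
        by (intro sum.cong) (auto simp: lookup_add lookup_coord_vec reduced_exps_def div)
      moreover have "mon_degree (coord_vec n (\<lambda>l. k * lookup c l)) = k * t"
        unfolding mon_degree_coord_vec sum_distrib_left[symmetric] s ..
      moreover have "keys (coord_vec n (\<lambda>l. k * lookup c l)) \<subseteq> {0..n}"
        using keys_coord_vec[of n] by force
      ultimately show "?f p \<in> {e \<in> exps n q. quot_deg n k e = t}"
        using p w True s c by (simp add: add_in_exps_iff reduced_exps_def)
    qed
    show "?g ` {e \<in> exps n q. quot_deg n k e = t} \<subseteq> ?W \<times> ?C"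
    proof (rule image_subsetI)
      fix e assume "e \<in> {e \<in> exps n q. quot_deg n k e = t}"
      then have e: "e \<in> exps n q" "quot_deg n k e = t" by simp_all
      have "mon_degree (?v e) = k * quot_deg n k e"
        by (simp add: mon_degree_coord_vec quot_deg_def sum_distrib_left)
      then have "e - ?v e \<in> exps n (q - k * t)"
        using e exps_decomposition[of n k e] by (metis add_in_exps_iff)
      moreover have "lookup (e - ?v e) l < k" if "l \<in> {1..n}" for l
        using that k by (simp add: lookup_minus lookup_coord_vec minus_mult_div_eq_mod)
      ultimately have "e - ?v e \<in> ?W" by (simp add: e(2) reduced_exps_def)
      moreover have "coord_vec n (\<lambda>l. lookup e l div k) \<in> ?C"
        using keys_coord_vec e(2) by (simp add: mon_degree_coord_vec quot_deg_def)
      ultimately show "?g e \<in> ?W \<times> ?C" by simp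
    qed
  qed
  then have "card {e \<in> exps n q. quot_deg n k e = t} = card (?W \<times> ?C)"
    by (simp add: bij_betw_same_card)
  moreover have "card ?C = (n - 1 + t) choose (n - 1)" using n by (intro card_exponents) auto
  ultimately show ?thesis using True by (simp add: card_cartesian_product)
qed

lemma card_eq_sum_fibres:
  assumes "finite A" "finite B" "g ` A \<subseteq> B"
  shows "card A = (\<Sum>t\<in>B. card {x \<in> A. g x = t})"
  using sum.group[OF assms, of "\<lambda>_. 1 :: nat"] unfolding card_eq_sum by (rule sym)

lemma card_quot_deg_greater:
  assumes n: "n \<ge> 1" and k: "k > 0"
  shows "real (card {e \<in> exps n i. j < quot_deg n k e}) =
    (\<Sum>s \<in> {s \<in> {1..n}. k * (j + s) \<le> i}.
       (-1) ^ (s + 1) * real ((n + (i - k * (j + s))) choose n)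
         * real ((j + s - 1) choose (s - 1)) * real ((j + n) choose (n - s)))"
proof -
  \<comment> \<open>Removing quotients of sum \<open>t\<close> from an exponent of degree \<open>i - k * (j + s)\<close> leaves a reduced one
    of degree \<open>i - k * (j + s + t)\<close>, so all counts below are combinations of the numbers \<open>a t\<close>.\<close>
  define a where "a t = (if k * t \<le> i then real (card (reduced_exps n k (i - k * t))) else 0)" for t
  have a0: "a t = 0" if "t > i" for t
  proof -
    have "t \<le> k * t" using k by simp
    then have "\<not> k * t \<le> i" using that by linarith
    then show ?thesis by (simp only: a_def if_False)
  qed
  have le_i: "quot_deg n k e \<le> q" if "e \<in> exps n q" for e q
  proof -
    have "quot_deg n k e \<le> k * quot_deg n k e" using k by simp
    then show ?thesis using exps_quot_deg_le[OF that, of k] by linarith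
  qed
  have cardB: "real (card {e \<in> exps n i. quot_deg n k e = t}) = a t * real ((n - 1 + t) choose (n - 1))" for t
    by (simp add: card_exps_quot_deg[OF n k] a_def)
  let ?c = "\<lambda>s. (-1) ^ (s + 1) * real ((j + s - 1) choose (s - 1)) * real ((j + n) choose (n - s))"
  have expand: "(if k * (j + s) \<le> i then real ((n + (i - k * (j + s))) choose n) else 0) =
      (\<Sum>u=1..i. a (j + u) * real ((n - 1 + u - s) choose (n - 1)))" if s: "s \<in> {1..n}" for s
  proof -
    have "(if k * (j + s) \<le> i then real ((n + (i - k * (j + s))) choose n) else 0) =
        (\<Sum>t\<le>i. a (j + s + t) * real ((n - 1 + t) choose (n - 1)))"
    proof (cases "k * (j + s) \<le> i")
      case True
      let ?q = "i - k * (j + s)"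
      have "card (exps n ?q) = (\<Sum>t\<le>i. card {e \<in> exps n ?q. quot_deg n k e = t})"
        using le_i by (intro card_eq_sum_fibres finite_exps) fastforce+
      moreover have "real (card {e \<in> exps n ?q. quot_deg n k e = t}) =
          a (j + s + t) * real ((n - 1 + t) choose (n - 1))" for t
      proof -
        have "k * t \<le> ?q \<longleftrightarrow> k * (j + s + t) \<le> i" "?q - k * t = i - k * (j + s + t)"
          using True by (auto simp: algebra_simps)
        then show ?thesis by (simp add: card_exps_quot_deg[OF n k] a_def)
      qed
      ultimately show ?thesis using True by (simp add: card_exps)
    next
      case False
      have "a (j + s + t) = 0" for t using False by (simp add: a_def algebra_simps)
      then show ?thesis using False by simp
    qed
    also have "\<dots> = (\<Sum>u=s..s+i. a (j + u) * real ((n - 1 + u - s) choose (n - 1)))"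
      by (rule sum.reindex_bij_witness[of _ "\<lambda>u. u - s" "\<lambda>t. s + t"]) (auto simp: add.assoc)
    also have "\<dots> = (\<Sum>u=1..i. a (j + u) * real ((n - 1 + u - s) choose (n - 1)))"
    proof (rule sum.mono_neutral_cong)
      \<comment> \<open>For \<open>1 \<le> u < s \<le> n\<close> the subtraction in \<open>n - 1 + u - s\<close> is not truncated, and
        the result is less than \<open>n - 1\<close>.\<close>
      fix u assume "u \<in> {1..i} - {s..s+i}"
      then have "n - 1 + u - s < n - 1" using s by auto
      then show "a (j + u) * real ((n - 1 + u - s) choose (n - 1)) = 0"
        by (simp only: binomial_eq_0 of_nat_0 mult_zero_right)
    qed (use s a0 in auto)
    finally show ?thesis .
  qed
  have ident: "(\<Sum>s=1..n. ?c s * real ((n - 1 + u - s) choose (n - 1))) =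
      real ((n - 1 + (j + u)) choose (n - 1))" if u: "u \<ge> 1" for u
  proof -
    obtain m v where m: "n = Suc m" "u = Suc v"
      using n u by (cases n; cases u) auto
    have "(\<Sum>s=1..n. ?c s * real ((n - 1 + u - s) choose (n - 1))) =
        (\<Sum>s\<le>m. (-1) ^ s * real ((j + s) choose s) * real ((j + Suc m) choose (m - s)) *
           real ((m + v - s) choose m))"
      unfolding m by (rule sum.reindex_bij_witness[of _ Suc "\<lambda>s. s - 1"])
        (auto simp: Suc_le_eq gr0_conv_Suc)
    then show ?thesis unfolding binomial_identity by (simp add: m add_ac)
  qed
  let ?H = "{e \<in> exps n i. j < quot_deg n k e}"
  have "card ?H = (\<Sum>t\<in>{j<..i}. card {e \<in> ?H. quot_deg n k e = t})"
    using le_i finite_exps[of n i] by (intro card_eq_sum_fibres) auto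
  also have "\<dots> = (\<Sum>t\<in>{j<..i}. card {e \<in> exps n i. quot_deg n k e = t})"
    by (intro sum.cong arg_cong[where f = card]) auto
  finally have "real (card ?H) = real (\<Sum>t\<in>{j<..i}. card {e \<in> exps n i. quot_deg n k e = t})"
    by (rule arg_cong)
  also have "\<dots> = (\<Sum>t\<in>{j<..i}. a t * real ((n - 1 + t) choose (n - 1)))"
    by (simp add: cardB)
  also have "\<dots> = (\<Sum>t\<in>{j+1..j+i}. a t * real ((n - 1 + t) choose (n - 1)))"
    by (rule sum.mono_neutral_left) (auto simp: a0)
  also have "\<dots> = (\<Sum>u=1..i. a (j + u) * real ((n - 1 + (j + u)) choose (n - 1)))"
    by (rule sum.reindex_bij_witness[of _ "\<lambda>u. j + u" "\<lambda>t. t - j"]) auto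
  also have "\<dots> = (\<Sum>u=1..i. a (j + u) * (\<Sum>s=1..n. ?c s * real ((n - 1 + u - s) choose (n - 1))))"
    using ident by simp
  also have "\<dots> = (\<Sum>s=1..n. ?c s * (\<Sum>u=1..i. a (j + u) * real ((n - 1 + u - s) choose (n - 1))))"
    unfolding sum_distrib_left by (subst sum.swap) (simp add: mult_ac)
  also have "\<dots> = (\<Sum>s=1..n. ?c s * (if k * (j + s) \<le> i then real ((n + (i - k * (j + s))) choose n) else 0))"
    using expand by (intro sum.cong) auto
  also have "\<dots> = (\<Sum>s \<in> {s \<in> {1..n}. k * (j + s) \<le> i}.
       (-1) ^ (s + 1) * real ((n + (i - k * (j + s))) choose n)
         * real ((j + s - 1) choose (s - 1)) * real ((j + n) choose (n - s)))"
    by (rule sum.mono_neutral_cong_right) (auto simp: mult_ac)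
  finally show ?thesis .
qed

lemma ibinom_int: "ibinom (int a) (int b) = real (a choose b)"
  by (simp add: ibinom_def binomial_gbinomial)

theorem mainTheorem7:
  fixes n k d j :: nat and \<xi> :: complex
  assumes "n \<ge> 1" and "d \<ge> 1" and "k \<ge> 2"
    and "primitive_root_of_unity k \<xi>"
    and "int j \<le> int d - 2"
  shows "\<exists>N. ring.dimension (R_ring n k d \<xi>) N (R_scalars n k d \<xi>)
               (R_component n k d \<xi> ((k - 1) * d + j)) \<and>
             real N = (\<Sum>s \<in> {s::nat. real s \<le> (real k - 1) / real k * (real d - real j)}.
               (- 1) ^ (s + 1)
               * ibinom (int n + (int k - 1) * (int d - int j) - int k * int s) (int n)
               * ibinom (int j + int s - 1) (int s - 1)
               * ibinom (int j + int n) (int n - int s))"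
proof -
  interpret power_ideal n k d j \<xi> using assms by unfold_locales auto
  define S where "S = {s::nat. real s \<le> (real k - 1) / real k * (real d - real j)}"
  define summand where "summand s = (- 1) ^ (s + 1)
      * ibinom (int n + (int k - 1) * (int d - int j) - int k * int s) (int n)
      * ibinom (int j + int s - 1) (int s - 1) * ibinom (int j + int n) (int n - int s)" for s :: nat
  have int_D: "int D = (int k - 1) * int d"
    using assms(3) by (simp add: D_def of_nat_diff)
  have S: "s \<in> S \<longleftrightarrow> k * (j + s) \<le> D + j" for s
  proof -
    have "s \<in> S \<longleftrightarrow> real s * real k \<le> (real k - 1) * (real d - real j)"
      using k by (simp add: S_def pos_le_divide_eq)
    also have "\<dots> \<longleftrightarrow> real_of_int (int k * (int j + int s)) \<le> real_of_int ((int k - 1) * int d + int j)"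
      by (simp add: algebra_simps)
    also have "\<dots> \<longleftrightarrow> int (k * (j + s)) \<le> int (D + j)"
      unfolding of_int_le_iff by (simp only: of_nat_mult of_nat_add int_D)
    finally show ?thesis by (simp only: of_nat_le_iff)
  qed
  have "s \<le> D + j" if "s \<in> S" for s
  proof -
    have "j + s \<le> k * (j + s)" using k by simp
    then show ?thesis using that unfolding S by linarith
  qed
  then have fin: "finite S" by (meson finite_atMost finite_subset atMost_iff subsetI)
  have "real (card std_exps) = (\<Sum>s \<in> {s \<in> {1..n}. k * (j + s) \<le> D + j}.
       (-1) ^ (s + 1) * real ((n + (D + j - k * (j + s))) choose n)
         * real ((j + s - 1) choose (s - 1)) * real ((j + n) choose (n - s)))"
    unfolding std_exps_def by (rule card_quot_deg_greater[OF assms(1) k])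
  also have "\<dots> = (\<Sum>s\<in>S. summand s)"
  proof (rule sum.mono_neutral_cong_left[OF fin])
    show "{s \<in> {1..n}. k * (j + s) \<le> D + j} \<subseteq> S" by (auto simp: S)
    \<comment> \<open>For \<open>s = 0\<close> and for \<open>s > n\<close> a lower entry of a binomial coefficient is negative.\<close>
    show "\<forall>s\<in>S - {s \<in> {1..n}. k * (j + s) \<le> D + j}. summand s = 0"
      by (auto simp: S summand_def ibinom_def)
    fix s assume s: "s \<in> {s \<in> {1..n}. k * (j + s) \<le> D + j}"
    have "int n + (int k - 1) * (int d - int j) - int k * int s = int (n + (D + j - k * (j + s)))"
      using s int_D by (simp add: of_nat_diff algebra_simps)
    moreover have "int j + int s - 1 = int (j + s - 1)" "int s - 1 = int (s - 1)"
        "int n - int s = int (n - s)" "int j + int n = int (j + n)"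
      using s by (auto simp: of_nat_diff)
    ultimately show "(-1) ^ (s + 1) * real ((n + (D + j - k * (j + s))) choose n)
        * real ((j + s - 1) choose (s - 1)) * real ((j + n) choose (n - s)) = summand s"
      unfolding summand_def by (simp only: ibinom_int)
  qed
  finally have "real (card std_exps) = (\<Sum>s\<in>S. summand s)" .
  then show ?thesis
    using dimension_R_component unfolding S_def summand_def D_def by blast
qed

end
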